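(* Let $G$ be a totally disconnected locally compact group, $\alpha\in\mathrm{End}(G)$ and $U\le G$ a compact open subgroup. For $i\in\mathbb{N}_0$ put $v_{-i}:=\alpha^{-i}(U)$, and let $\Gamma_+$ be the directed graph with $$V(\Gamma_+)=\{uv_{-i}\mid u\in U,\ i\in\mathbb{N}_0\},\qquad E(\Gamma_+)=\{(uv_{-i},uv_{-i-1})\mid u\in U,\ i\in\mathbb{N}_0\}.$$ (i) If $\{v_{-i}\mid i\in\mathbb{N}_0\}$ is finite, then there is a compact open subgroup $V$ of $G$ with $\alpha(V)\le V$ which is tidy for $\alpha$, and $s(\alpha)=1$. (ii) If $\{v_{-i}\mid i\in\mathbb{N}_0\}$ is infinite, then $U$ is tidy for $\alpha$ if and only if $\Gamma_+$ is a directed tree, rooted at $v_0$, with constant in-valency (excluding the root) equal to $1$ and constant out-valency. In this case, $s(\alpha)$ equals said out-valency.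
   Context: $\mathbb{N}=\{1,2,\dots\}$, $\mathbb{N}_0=\mathbb{N}\cup\{0\}$. $\mathrm{End}(G)$ is the semigroup of continuous homomorphisms $G\to G$. $\alpha^{-i}(U)$ denotes the preimage of $U$ under $\alpha^i$; it is regarded as an element of the power set of $G$, and $uv_{-i}=u\alpha^{-i}(U)$ is a left coset, so vertices are equal iff they are equal as subsets of $G$. For a compact open subgroup $U\le G$ set $U_0:=U$, $U_{n+1}:=U\cap\alpha(U_n)$ and $U_{-n}:=\bigcap_{k=0}^n\alpha^{-k}(U)$ for $n\in\mathbb{N}_0$; $U_+:=\bigcap_{n\in\mathbb{N}_0}U_n$, $U_-:=\bigcap_{n\in\mathbb{N}_0}U_{-n}$, $U_{--}:=\bigcup_{n\in\mathbb{N}_0}\alpha^{-n}(U_-)$. $U$ is tidy above for $\alpha$ if $U=U_+U_-$, tidy below for $\alpha$ if $U_{--}$ is closed in $G$, and tidy for $\alpha$ if it is both. The scale is $s(\alpha)=\min\{[\alpha(W):W\cap\alpha(W)]\mid W\le G\text{ compact open}\}$. Directed graph: vertex set $V$ and edge set $E\subseteq V\times V$. The in-valency (out-valency) of $v$ is the number of $w$ with $(w,v)\in E$ (resp. $(v,w)\in E$). An arc from $v$ to $v'$ is a tuple of distinct vertices $(v=w_0,\dots,w_k=v')$ with all $(w_i,w_{i+1})\in E$. A directed graph is a tree if its underlying undirected graph is connected and has no non-trivial cycles; a directed tree is rooted at $v_0$ if every vertex other than $v_0$ is reached by an arc from $v_0$ (then the in-valency of $v_0$ is $0$). *)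

theory Defs
  imports
    "HOL-Analysis.Analysis"
    "HOL-Algebra.Coset"
    "HOL-Algebra.Left_Coset"
    "Graph_Theory.Digraph_Component"
begin

section \<open>Totally disconnected locally compact groups\<close>

text \<open>The Hausdorff property is not listed: it follows, since points are connected components
  (hence closed) and the underlying structure is a group.\<close>

locale tdlc_group = group G for G :: "('a, 'b) monoid_scheme" (structure) +
  fixes T :: "'a topology"
  assumes topspace_carrier: "topspace T = carrier G"
    and continuous_mult: "continuous_map (prod_topology T T) T (\<lambda>(x, y). x \<otimes> y)"
    and continuous_inv: "continuous_map T T (\<lambda>x. inv x)"
    and locally_compact: "locally_compact_space T"
    and totally_disconnected: "\<And>x. x \<in> topspace T \<Longrightarrow> connected_component_of_set T x = {x}"

definition continuous_End :: "('a, 'b) monoid_scheme \<Rightarrow> 'a topology \<Rightarrow> ('a \<Rightarrow> 'a) set" where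
  "continuous_End G T = {\<alpha>. \<alpha> \<in> hom G G \<and> continuous_map T T \<alpha>}"

definition compact_open_subgroup :: "('a, 'b) monoid_scheme \<Rightarrow> 'a topology \<Rightarrow> 'a set \<Rightarrow> bool" where
  "compact_open_subgroup G T U \<longleftrightarrow> subgroup U G \<and> compactin T U \<and> openin T U"

section \<open>Tidy subgroups and the scale\<close>

text \<open>Elements of the HOL type outside \<open>carrier G\<close> are irrelevant, so preimages
  are taken within the carrier.\<close>

definition preimage_iter ::
  "('a, 'b) monoid_scheme \<Rightarrow> ('a \<Rightarrow> 'a) \<Rightarrow> nat \<Rightarrow> 'a set \<Rightarrow> 'a set" where
  "preimage_iter G \<alpha> n A = {x \<in> carrier G. (\<alpha> ^^ n) x \<in> A}"

primrec U_pos :: "('a \<Rightarrow> 'a) \<Rightarrow> 'a set \<Rightarrow> nat \<Rightarrow> 'a set" where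
  "U_pos \<alpha> U 0 = U"
| "U_pos \<alpha> U (Suc n) = U \<inter> \<alpha> ` U_pos \<alpha> U n"

definition U_neg :: "('a, 'b) monoid_scheme \<Rightarrow> ('a \<Rightarrow> 'a) \<Rightarrow> 'a set \<Rightarrow> nat \<Rightarrow> 'a set" where
  "U_neg G \<alpha> U n = (\<Inter>k\<le>n. preimage_iter G \<alpha> k U)"

definition U_plus :: "('a \<Rightarrow> 'a) \<Rightarrow> 'a set \<Rightarrow> 'a set" where
  "U_plus \<alpha> U = (\<Inter>n. U_pos \<alpha> U n)"

definition U_minus :: "('a, 'b) monoid_scheme \<Rightarrow> ('a \<Rightarrow> 'a) \<Rightarrow> 'a set \<Rightarrow> 'a set" where
  "U_minus G \<alpha> U = (\<Inter>n. U_neg G \<alpha> U n)"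

definition U_minus_minus :: "('a, 'b) monoid_scheme \<Rightarrow> ('a \<Rightarrow> 'a) \<Rightarrow> 'a set \<Rightarrow> 'a set" where
  "U_minus_minus G \<alpha> U = (\<Union>n. preimage_iter G \<alpha> n (U_minus G \<alpha> U))"

definition tidy_above :: "('a, 'b) monoid_scheme \<Rightarrow> ('a \<Rightarrow> 'a) \<Rightarrow> 'a set \<Rightarrow> bool" where
  "tidy_above G \<alpha> U \<longleftrightarrow> U = U_plus \<alpha> U <#>\<^bsub>G\<^esub> U_minus G \<alpha> U"

definition tidy_below ::
  "('a, 'b) monoid_scheme \<Rightarrow> 'a topology \<Rightarrow> ('a \<Rightarrow> 'a) \<Rightarrow> 'a set \<Rightarrow> bool" where
  "tidy_below G T \<alpha> U \<longleftrightarrow> closedin T (U_minus_minus G \<alpha> U)"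

definition tidy ::
  "('a, 'b) monoid_scheme \<Rightarrow> 'a topology \<Rightarrow> ('a \<Rightarrow> 'a) \<Rightarrow> 'a set \<Rightarrow> bool" where
  "tidy G T \<alpha> U \<longleftrightarrow> tidy_above G \<alpha> U \<and> tidy_below G T \<alpha> U"

definition subgroup_index :: "('a, 'b) monoid_scheme \<Rightarrow> 'a set \<Rightarrow> 'a set \<Rightarrow> nat" where
  "subgroup_index G A B = card (lcosets\<^bsub>G\<lparr>carrier := A\<rparr>\<^esub> B)"

text \<open>The indices below are finite, because \<open>\<alpha> ` W\<close> is compact and \<open>W\<close> is open; so the
  convention \<open>card A = 0\<close> for infinite \<open>A\<close> plays no role.  The minimum exists, because
  compact open subgroups exist (van Dantzig).\<close>

definition scale :: "('a, 'b) monoid_scheme \<Rightarrow> 'a topology \<Rightarrow> ('a \<Rightarrow> 'a) \<Rightarrow> nat" where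
  "scale G T \<alpha> =
    (LEAST n. \<exists>W. compact_open_subgroup G T W \<and> n = subgroup_index G (\<alpha> ` W) (W \<inter> \<alpha> ` W))"

section \<open>Directed trees\<close>

text \<open>The library constant \<^const>\<open>tree\<close> only excludes directed cycles, so it is not used here.
  Cycles of the underlying undirected graph are cycles of the symmetrised digraph.  The trivial
  ones run along one edge and back along the same edge.  A loop is a non-trivial cycle, and so is a
  pair of antiparallel edges, as these are two different edges of the underlying graph; otherwise
  the root of a rooted tree could have positive in-valency.\<close>

definition trivial_cycle :: "'v pair_pre_digraph \<Rightarrow> ('v \<times> 'v) list \<Rightarrow> bool" where
  "trivial_cycle \<Gamma> p \<longleftrightarrow>
    (\<exists>v w. p = [(v, w), (w, v)] \<and> \<not> ((v, w) \<in> parcs \<Gamma> \<and> (w, v) \<in> parcs \<Gamma>))"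

definition directed_tree :: "'v pair_pre_digraph \<Rightarrow> bool" where
  "directed_tree \<Gamma> \<longleftrightarrow>
    pair_wf_digraph \<Gamma> \<and>
    Digraph_Component.connected (with_proj \<Gamma>) \<and>
    (\<forall>p. pre_digraph.cycle (with_proj (mk_symmetric (with_proj \<Gamma>))) p \<longrightarrow> trivial_cycle \<Gamma> p)"

definition rooted_at :: "'v pair_pre_digraph \<Rightarrow> 'v \<Rightarrow> bool" where
  "rooted_at \<Gamma> r \<longleftrightarrow>
    r \<in> pverts \<Gamma> \<and>
    (\<forall>v \<in> pverts \<Gamma> - {r}. \<exists>p. pre_digraph.apath (with_proj \<Gamma>) r p v)"

text \<open>Valencies are compared as cardinals, since \<^const>\<open>out_degree\<close> does not distinguish
  infinite valency from valency \<open>0\<close>.\<close>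

definition constant_out_valency :: "'v pair_pre_digraph \<Rightarrow> bool" where
  "constant_out_valency \<Gamma> \<longleftrightarrow>
    (\<forall>v \<in> pverts \<Gamma>. \<forall>w \<in> pverts \<Gamma>.
      out_arcs (with_proj \<Gamma>) v \<approx> out_arcs (with_proj \<Gamma>) w)"

section \<open>The graph \<open>\<Gamma>\<^sub>+\<close>\<close>

definition Gamma_plus ::
  "('a, 'b) monoid_scheme \<Rightarrow> ('a \<Rightarrow> 'a) \<Rightarrow> 'a set \<Rightarrow> 'a set pair_pre_digraph" where
  "Gamma_plus G \<alpha> U =
    \<lparr> pverts = {u <#\<^bsub>G\<^esub> preimage_iter G \<alpha> i U | u i. u \<in> U},
      parcs = {(u <#\<^bsub>G\<^esub> preimage_iter G \<alpha> i U, u <#\<^bsub>G\<^esub> preimage_iter G \<alpha> (Suc i) U) | u i. u \<in> U} \<rparr>"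

end

theory Submission
  imports Defs
begin

text \<open>Write \<open>v\<^sub>i = \<alpha>\<^sup>-\<^sup>i(U)\<close>, which is \<open>v\<^sub>-\<^sub>i\<close> in the informal statement.  When infinitely many of
  them occur they are pairwise distinct, since \<open>v\<^sub>i = v\<^sub>j\<close> makes the sequence periodic.  A coset
  determines its subgroup, so the vertex \<open>uv\<^sub>i\<close> then has level \<open>i\<close>, edges raise the level by
  one, and the shape of \<open>\<Gamma>\<^sub>+\<close> is a matter of indices: the vertex \<open>v\<^sub>i\<^sub>+\<^sub>1\<close> has
  \<open>[U \<inter> v\<^sub>i\<^sub>+\<^sub>1 : U \<inter> v\<^sub>i\<^sub>+\<^sub>1 \<inter> v\<^sub>i]\<close> parents, the vertex \<open>v\<^sub>i\<close> has
  \<open>[U \<inter> v\<^sub>i : U \<inter> v\<^sub>i \<inter> v\<^sub>i\<^sub>+\<^sub>1]\<close> children, and \<open>U\<close> acts transitively on each level.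
  A graded rooted graph with unique parents is a tree, because a cycle enters and leaves a vertex of
  maximal level through its parent.  Hence \<open>\<Gamma>\<^sub>+\<close> has the required shape iff
    (a) \<open>U \<inter> v\<^sub>i\<^sub>+\<^sub>1 \<subseteq> v\<^sub>i\<close> for all \<open>i\<close>, equivalently \<open>U \<inter> v\<^sub>i = U\<^sub>-\<^sub>i\<close> for all \<open>i\<close>, and
    (b) the indices \<open>[U\<^sub>-\<^sub>i : U\<^sub>-\<^sub>i\<^sub>-\<^sub>1]\<close> all agree with \<open>c = [U : U \<inter> v\<^sub>1]\<close>.

  Condition (b) is tidiness above.  Indeed \<open>\<alpha>\<^sup>i\<close> maps \<open>U\<^sub>-\<^sub>i\<close> onto \<open>U\<^sub>i\<close>, which turns the index into
  \<open>[U\<^sub>i : U\<^sub>i \<inter> v\<^sub>1]\<close>; equality with \<open>c\<close> says \<open>U = U\<^sub>i(U \<inter> v\<^sub>1)\<close>, and compactness together with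
  \<open>U\<^sub>+ \<subseteq> \<alpha>(U\<^sub>+)\<close> improves this to \<open>U = U\<^sub>+U\<^sub>-\<close> (\<open>tidy_above_iff_index\<close>).  Given (b), condition
  (a) is tidiness below.  From (a) one gets \<open>U\<^sub>-\<^sub>- \<inter> U = U\<^sub>-\<close>, so \<open>U\<^sub>-\<^sub>-\<close> is locally closed, hence
  closed.  Conversely, if \<open>U\<^sub>-\<^sub>-\<close> is closed, Baire's theorem gives one \<open>N\<close> with
  \<open>\<alpha>\<^sup>N(U\<^sub>-\<^sub>- \<inter> U) \<subseteq> U\<^sub>-\<close>; pulling elements of \<open>U\<^sub>+ \<inter> U\<^sub>-\<^sub>-\<close> back \<open>N\<close> times inside \<open>U\<^sub>+\<close> shows that
  they lie in \<open>U\<^sub>-\<close>, and (a) follows by factoring elements of \<open>U\<close> as in \<open>U = U\<^sub>+U\<^sub>-\<close>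
  (\<open>tidy_iff\<close>).

  The scale is read off from growth rates (\<open>scale_tidy\<close>).  For tidy \<open>U\<close> one has
  \<open>[U : U \<inter> \<alpha>\<^sup>-\<^sup>n(U)] = c\<^sup>n\<close>, while any compact open \<open>W\<close> with \<open>d = [\<alpha>(W) : W \<inter> \<alpha>(W)]\<close>
  satisfies \<open>[W : W \<inter> \<alpha>\<^sup>-\<^sup>n(W)] \<le> d\<^sup>n\<close>.  The two left hand sides differ at most by a factor
  that does not depend on \<open>n\<close>, so \<open>c \<le> d\<close>.  When only finitely many \<open>v\<^sub>i\<close> occur, \<open>U\<^sub>-\<close> is a finite
  intersection of open groups, and it is an invariant tidy subgroup of index \<open>1\<close>.\<close>

(* leaves left cosets as the only reading of <# *)
no_notation subset_mset (infix \<open><#\<close> 50)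

section \<open>Relative indices\<close>

lemma image_lepoll_image:
  assumes "\<And>a b. \<lbrakk>a \<in> A; b \<in> A; g a = g b\<rbrakk> \<Longrightarrow> f a = f b"
  shows "f ` A \<lesssim> g ` A"
proof -
  have "f ` A \<subseteq> (\<lambda>y. f (inv_into A g y)) ` (g ` A)"
  proof
    fix y assume "y \<in> f ` A"
    then obtain a where a: "a \<in> A" "y = f a" by blast
    have "f (inv_into A g (g a)) = f a"
      using a(1) by (intro assms) (auto intro: inv_into_into f_inv_into_f)
    then show "y \<in> (\<lambda>y. f (inv_into A g y)) ` (g ` A)"
      using a by force
  qed
  then show ?thesis
    by (meson image_lepoll lepoll_trans subset_imp_lepoll)
qed

lemma image_eqpoll_image:
  assumes "\<And>a b. \<lbrakk>a \<in> A; b \<in> A\<rbrakk> \<Longrightarrow> f a = f b \<longleftrightarrow> g a = g b"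
  shows "f ` A \<approx> g ` A"
  using assms by (intro lepoll_antisym image_lepoll_image) auto

text \<open>The group \<open>B\<close> need not lie in \<open>A\<close>: a coset \<open>aB\<close> with \<open>a \<in> A\<close> meets \<open>A\<close> in \<open>a(A \<inter> B)\<close>, so the
  number of such cosets is \<open>[A : A \<inter> B]\<close>, and intersections can be left implicit.\<close>

definition left_cosets_in :: "('a, 'b) monoid_scheme \<Rightarrow> 'a set \<Rightarrow> 'a set \<Rightarrow> 'a set set" where
  "left_cosets_in G A B = (\<lambda>a. a <#\<^bsub>G\<^esub> B) ` A"

definition rel_index :: "('a, 'b) monoid_scheme \<Rightarrow> 'a set \<Rightarrow> 'a set \<Rightarrow> nat" where
  "rel_index G A B = card (left_cosets_in G A B)"

context group
begin

lemma l_coset_eq_iff: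
  assumes "subgroup B G" "a \<in> carrier G" "b \<in> carrier G"
  shows "a <# B = b <# B \<longleftrightarrow> inv a \<otimes> b \<in> B"
proof
  assume "a <# B = b <# B"
  then have "b \<in> a <# B" using lcos_self[OF assms(3,1)] by simp
  then show "inv a \<otimes> b \<in> B" using subgroup.lcos_module_imp[OF assms(1) is_group assms(2)] by blast
next
  assume "inv a \<otimes> b \<in> B"
  then have "b \<in> a <# B" using subgroup.lcos_module_rev[OF assms(1) is_group assms(2,3)] by blast
  then show "a <# B = b <# B" using l_repr_independence assms by blast
qed

lemma l_coset_mem_iff:
  assumes "B \<subseteq> carrier G" "a \<in> carrier G"
  shows "x \<in> a <# B \<longleftrightarrow> x \<in> carrier G \<and> inv a \<otimes> x \<in> B"
proof
  assume "x \<in> a <# B"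
  then obtain b where "b \<in> B" "x = a \<otimes> b" by (auto simp: l_coset_def)
  then show "x \<in> carrier G \<and> inv a \<otimes> x \<in> B"
    using assms by (auto simp: m_assoc[symmetric] subset_iff)
next
  assume x: "x \<in> carrier G \<and> inv a \<otimes> x \<in> B"
  then have "x = a \<otimes> (inv a \<otimes> x)" using assms by (simp add: m_assoc[symmetric])
  then show "x \<in> a <# B" using x by (auto simp: l_coset_def)
qed

lemma left_cosets_in_lepoll:
  assumes "subgroup B G" "subgroup C G" "A \<subseteq> carrier G"
    and "\<And>a b. \<lbrakk>a \<in> A; b \<in> A; inv a \<otimes> b \<in> B\<rbrakk> \<Longrightarrow> inv a \<otimes> b \<in> C"
  shows "left_cosets_in G A C \<lesssim> left_cosets_in G A B"
  unfolding left_cosets_in_def using assms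
  by (intro image_lepoll_image) (auto simp: l_coset_eq_iff subset_iff)

lemma left_cosets_in_Int_absorb:
  assumes "subgroup A G" "subgroup B G"
  shows "left_cosets_in G A (A \<inter> B) \<approx> left_cosets_in G A B"
  using assms subgroups_Inter_pair[OF assms]
  by (intro lepoll_antisym left_cosets_in_lepoll)
     (auto dest: subgroup.subset subgroup.m_closed subgroup.m_inv_closed)

text \<open>Fix a representative \<open>r\<close> of each coset of \<open>B\<close> that meets \<open>A\<close>.  A coset \<open>a(B \<inter> C)\<close> is
  determined by \<open>aB\<close> and \<open>r\<^sup>-\<^sup>1aC\<close>, and these two vary independently.  This is the
  multiplicativity \<open>[A : A \<inter> B \<inter> C] = [A : A \<inter> B] \<cdot> [A \<inter> B : A \<inter> B \<inter> C]\<close>.\<close>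

lemma left_cosets_in_Int_eqpoll:
  assumes A: "subgroup A G" and B: "subgroup B G" and C: "subgroup C G"
  shows "left_cosets_in G A (B \<inter> C) \<approx> left_cosets_in G A B \<times> left_cosets_in G (A \<inter> B) C"
proof -
  define r where "r X = inv_into A (\<lambda>a. a <# B) X" for X
  have r_in: "r (a <# B) \<in> A" and r_eq: "r (a <# B) <# B = a <# B" if "a \<in> A" for a
    using that inv_into_into[of "a <# B" "\<lambda>a. a <# B" A] f_inv_into_f[of "a <# B" "\<lambda>a. a <# B" A]
    unfolding r_def by blast+
  have carr: "a \<in> carrier G" if "a \<in> A" for a using that subgroup.subset[OF A] by blast
  have rB: "inv r (a <# B) \<otimes> a \<in> A \<inter> B" if "a \<in> A" for a
    using l_coset_eq_iff[OF B carr[OF r_in[OF that]] carr[OF that]] r_eq[OF that] r_in[OF that] that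
    by (auto intro: subgroup.m_closed[OF A] subgroup.m_inv_closed[OF A])
  define \<phi> where "\<phi> a = (a <# B, (inv r (a <# B) \<otimes> a) <# C)" for a
  have quot: "inv (inv x \<otimes> a) \<otimes> (inv x \<otimes> b) = inv a \<otimes> b"
    if "x \<in> carrier G" "a \<in> carrier G" "b \<in> carrier G" for x a b
    using that by (simp add: inv_mult_group m_assoc) (simp add: m_assoc[symmetric])
  have "left_cosets_in G A (B \<inter> C) \<approx> \<phi> ` A"
    unfolding left_cosets_in_def
  proof (rule image_eqpoll_image)
    fix a b assume ab: "a \<in> A" "b \<in> A"
    have "\<phi> a = \<phi> b \<longleftrightarrow> a <# B = b <# B \<and> inv a \<otimes> b \<in> C"
      unfolding \<phi>_def using ab
      by (auto simp: l_coset_eq_iff[OF C] carr r_in quot)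
    then show "a <# (B \<inter> C) = b <# (B \<inter> C) \<longleftrightarrow> \<phi> a = \<phi> b"
      using ab by (simp add: l_coset_eq_iff subgroups_Inter_pair B C carr)
  qed
  also have "\<phi> ` A = left_cosets_in G A B \<times> left_cosets_in G (A \<inter> B) C"
  proof
    show "\<phi> ` A \<subseteq> left_cosets_in G A B \<times> left_cosets_in G (A \<inter> B) C"
      unfolding left_cosets_in_def \<phi>_def using rB by auto
    show "left_cosets_in G A B \<times> left_cosets_in G (A \<inter> B) C \<subseteq> \<phi> ` A"
    proof clarify
      fix X Y assume "X \<in> left_cosets_in G A B" "Y \<in> left_cosets_in G (A \<inter> B) C"
      then obtain a b where ab: "a \<in> A" "X = a <# B" "b \<in> A" "b \<in> B" "Y = b <# C"
        by (auto simp: left_cosets_in_def)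
      let ?x = "r (a <# B) \<otimes> b"
      have x: "?x \<in> A" using ab r_in by (auto intro: subgroup.m_closed[OF A])
      have inv_x: "inv r (a <# B) \<otimes> ?x = b"
        using ab r_in carr by (simp add: m_assoc[symmetric])
      have "r (a <# B) <# B = ?x <# B"
        using l_coset_eq_iff[OF B carr[OF r_in[OF ab(1)]] carr[OF x]] inv_x ab by simp
      then have "?x <# B = a <# B" using r_eq[OF ab(1)] by simp
      then have "\<phi> ?x = (X, Y)" unfolding \<phi>_def using inv_x ab by simp
      then show "(X, Y) \<in> \<phi> ` A" using x by (metis image_eqI)
    qed
  qed
  finally show ?thesis .
qed

lemma rel_index_Int:
  assumes "subgroup A G" "subgroup B G" "subgroup C G"
  shows "rel_index G A (B \<inter> C) = rel_index G A B * rel_index G (A \<inter> B) C"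
  using left_cosets_in_Int_eqpoll[OF assms]
  by (auto simp: rel_index_def eqpoll_def card_cartesian_product dest: bij_betw_same_card)

lemma rel_index_eqpoll:
  "left_cosets_in G A B \<approx> left_cosets_in G C D \<Longrightarrow> rel_index G A B = rel_index G C D"
  by (auto simp: rel_index_def eqpoll_def dest: bij_betw_same_card)

lemma rel_index_mono_left:
  "A \<subseteq> A' \<Longrightarrow> finite (left_cosets_in G A' B) \<Longrightarrow> rel_index G A B \<le> rel_index G A' B"
  unfolding rel_index_def left_cosets_in_def by (intro card_mono image_mono)

lemma rel_index_antimono_right:
  assumes "subgroup B G" "subgroup C G" "A \<subseteq> carrier G" "B \<subseteq> C"
    and "finite (left_cosets_in G A B)"
  shows "rel_index G A C \<le> rel_index G A B"
proof -
  have "left_cosets_in G A C \<lesssim> left_cosets_in G A B"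
    using assms(4) by (intro left_cosets_in_lepoll[OF assms(1-3)]) blast
  moreover from this have "finite (left_cosets_in G A C)"
    using assms(5) by (meson finite_surj lepoll_iff)
  ultimately show ?thesis using assms(5) by (simp add: rel_index_def lepoll_iff_card_le)
qed

lemma rel_index_eq_1:
  assumes "subgroup B G" "A \<subseteq> B" "A \<noteq> {}"
  shows "rel_index G A B = 1"
proof -
  have "a <# B = B" if "a \<in> A" for a
    using that assms by (metis coset_join3 subgroup.mem_carrier subsetD)
  then have "left_cosets_in G A B = {B}" using assms(3) by (auto simp: left_cosets_in_def)
  then show ?thesis by (simp add: rel_index_def)
qed

lemma rel_index_Int_absorb:
  assumes "subgroup A G" "subgroup B G"
  shows "rel_index G A (A \<inter> B) = rel_index G A B"
  by (rule rel_index_eqpoll[OF left_cosets_in_Int_absorb[OF assms]])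

end

section \<open>Topological groups\<close>

context tdlc_group
begin

abbreviation compact_open :: "'a set \<Rightarrow> bool" where
  "compact_open U \<equiv> compact_open_subgroup G T U"

lemma continuous_map_mult:
  assumes "continuous_map X T f" "continuous_map X T g"
  shows "continuous_map X T (\<lambda>x. f x \<otimes> g x)"
proof -
  have "continuous_map X T ((\<lambda>(x, y). x \<otimes> y) \<circ> (\<lambda>x. (f x, g x)))"
    by (rule continuous_map_compose[OF _ continuous_mult])
       (simp add: continuous_map_paired assms)
  then show ?thesis by (simp add: o_def)
qed

lemma continuous_map_inv:
  "continuous_map X T f \<Longrightarrow> continuous_map X T (\<lambda>x. inv (f x))"
  using continuous_map_compose[OF _ continuous_inv, of X f] by (simp add: o_def)

lemma continuous_map_translation:
  assumes "a \<in> carrier G"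
  shows "continuous_map T T (\<lambda>x. a \<otimes> x)"
  using continuous_map_mult[of T "\<lambda>_. a" "\<lambda>x. x"] assms
  by (simp add: topspace_carrier)

lemma l_coset_eq_preimage:
  assumes "B \<subseteq> carrier G" "a \<in> carrier G"
  shows "a <# B = {x \<in> topspace T. inv a \<otimes> x \<in> B}"
  using l_coset_mem_iff[OF assms] by (auto simp: topspace_carrier)

lemma openin_l_coset:
  assumes "openin T B" "a \<in> carrier G"
  shows "openin T (a <# B)"
proof -
  have "B \<subseteq> carrier G" using openin_subset[OF assms(1)] by (simp add: topspace_carrier)
  then show ?thesis
    using openin_continuous_map_preimage[OF continuous_map_translation assms(1), of "inv a"] assms(2)
    by (simp add: l_coset_eq_preimage)
qed

text \<open>Components are closed, so points are; the inequality \<open>x \<noteq> y\<close> is then the open condition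
  \<open>x\<^sup>-\<^sup>1y \<noteq> 1\<close> on pairs.\<close>

lemma Hausdorff: "Hausdorff_space T"
  unfolding Hausdorff_space_def
proof (intro allI impI)
  fix x y assume xy: "x \<in> topspace T \<and> y \<in> topspace T \<and> x \<noteq> y"
  have "closedin T {\<one>}"
    using closedin_connected_component_of[of T \<one>] totally_disconnected[of \<one>]
    by (simp add: topspace_carrier)
  then have op: "openin T (topspace T - {\<one>})" by blast
  have cont: "continuous_map (prod_topology T T) T (\<lambda>p. inv (fst p) \<otimes> snd p)"
    by (intro continuous_map_mult continuous_map_inv continuous_map_fst continuous_map_snd)
  let ?S = "{p \<in> topspace (prod_topology T T). inv (fst p) \<otimes> snd p \<in> topspace T - {\<one>}}"
  have "openin (prod_topology T T) ?S"
    using openin_continuous_map_preimage[OF cont op] .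
  moreover have "(x, y) \<in> ?S"
    using xy by (auto simp: topspace_carrier) (metis inv_equality inv_inv inv_closed)
  ultimately have "\<exists>P Q. openin T P \<and> openin T Q \<and> x \<in> P \<and> y \<in> Q \<and> P \<times> Q \<subseteq> ?S"
    using iffD1[OF openin_prod_topology_alt, of T T ?S] by simp
  then obtain P Q where PQ: "openin T P" "openin T Q" "x \<in> P" "y \<in> Q" "P \<times> Q \<subseteq> ?S"
    by (elim exE conjE)
  have "disjnt P Q"
  proof (rule ccontr)
    assume "\<not> disjnt P Q"
    then obtain z where "z \<in> P" "z \<in> Q" by (auto simp: disjnt_iff)
    then have "(z, z) \<in> ?S" using PQ by blast
    then show False by (auto simp: topspace_carrier)
  qed
  then show "\<exists>P Q. openin T P \<and> openin T Q \<and> x \<in> P \<and> y \<in> Q \<and> disjnt P Q"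
    using PQ by blast
qed

lemma compactin_closedin: "compactin T K \<Longrightarrow> closedin T K"
  using Hausdorff compactin_imp_closedin by blast

lemma finite_left_cosets_in:
  assumes A: "compactin T A" and B: "subgroup B G" "openin T B"
  shows "finite (left_cosets_in G A B)"
proof -
  have Ac: "A \<subseteq> carrier G" using compactin_subset_topspace[OF A] by (simp add: topspace_carrier)
  have "A \<subseteq> \<Union> (left_cosets_in G A B)"
    using lcos_self[OF _ B(1)] Ac by (auto simp: left_cosets_in_def)
  moreover have "\<And>X. X \<in> left_cosets_in G A B \<Longrightarrow> openin T X"
    using openin_l_coset[OF B(2)] Ac by (auto simp: left_cosets_in_def)
  ultimately obtain \<F> where F: "finite \<F>" "\<F> \<subseteq> left_cosets_in G A B" "A \<subseteq> \<Union>\<F>"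
    using compactinD[OF A, of "left_cosets_in G A B"] by auto
  have "left_cosets_in G A B \<subseteq> \<F>"
  proof
    fix X assume "X \<in> left_cosets_in G A B"
    then obtain a where a: "a \<in> A" "X = a <# B" by (auto simp: left_cosets_in_def)
    obtain Y where Y: "Y \<in> \<F>" "a \<in> Y" using a F(3) by auto
    then obtain b where b: "b \<in> A" "b <# B \<in> \<F>" "a \<in> b <# B"
      using F(2) unfolding left_cosets_in_def by auto
    then show "X \<in> \<F>"
      using a l_repr_independence[OF b(3) _ B(1)] Ac by auto
  qed
  then show ?thesis using F(1) finite_subset by blast
qed

lemma rel_index_pos:
  assumes "compactin T A" "A \<noteq> {}" "subgroup B G" "openin T B"
  shows "rel_index G A B > 0"
  using finite_left_cosets_in[OF assms(1,3,4)] assms(2)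
  by (auto simp: rel_index_def card_gt_0_iff left_cosets_in_def)

text \<open>A locally closed subgroup is closed: a point \<open>y\<close> of the closure of \<open>H\<close> can be
  translated by an element of \<open>H\<close> into a neighbourhood of \<open>1\<close> in which \<open>H\<close> is closed.\<close>

lemma locally_closed_subgroup_closed:
  assumes H: "subgroup H G" and W: "subgroup W G" "openin T W" and HW: "closedin T (H \<inter> W)"
  shows "closedin T H"
proof -
  have Hc: "H \<subseteq> carrier G" using subgroup.subset[OF H] .
  have "T closure_of H \<subseteq> H"
  proof
    fix y assume y: "y \<in> T closure_of H"
    then have yc: "y \<in> carrier G" by (auto simp: in_closure_of topspace_carrier)
    obtain h where h: "h \<in> H" "h \<in> y <# W"
      using y openin_l_coset[OF W(2) yc] lcos_self[OF yc W(1)] unfolding in_closure_of by blast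
    have hc: "h \<in> carrier G" using h Hc by blast
    have "inv y \<otimes> h \<in> W" using h l_coset_mem_iff[OF subgroup.subset[OF W(1)] yc] by blast
    then have "inv (inv y \<otimes> h) \<in> W" by (rule subgroup.m_inv_closed[OF W(1)])
    then have hyW: "inv h \<otimes> y \<in> W" using yc hc by (simp add: inv_mult_group)
    have "inv h \<otimes> y \<in> T closure_of (H \<inter> W)"
      unfolding in_closure_of
    proof (intro conjI allI impI)
      show "inv h \<otimes> y \<in> topspace T" using hc yc by (simp add: topspace_carrier)
      fix P assume P: "inv h \<otimes> y \<in> P \<and> openin T P"
      have Pc: "P \<inter> W \<subseteq> carrier G" using subgroup.subset[OF W(1)] by blast
      have "y \<in> h <# (P \<inter> W)" using l_coset_mem_iff[OF Pc hc] P hyW yc by blast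
      moreover have "openin T (h <# (P \<inter> W))" using openin_l_coset P W(2) hc by blast
      ultimately obtain z where z: "z \<in> H" "z \<in> h <# (P \<inter> W)"
        using y unfolding in_closure_of by blast
      have "inv h \<otimes> z \<in> H" using z h subgroup.m_closed[OF H] subgroup.m_inv_closed[OF H] by blast
      moreover have "inv h \<otimes> z \<in> P \<inter> W" using z l_coset_mem_iff[OF Pc hc] by blast
      ultimately show "\<exists>x. x \<in> H \<inter> W \<and> x \<in> P" by blast
    qed
    then have "inv h \<otimes> y \<in> H" using closure_of_closedin[OF HW] by simp
    then have "h \<otimes> (inv h \<otimes> y) \<in> H" using h subgroup.m_closed[OF H] by blast
    then show "y \<in> H" using hc yc by (simp add: m_assoc[symmetric])
  qed
  then show ?thesis
    using Hc by (metis closure_of_subset closure_of_subset_eq subset_antisym topspace_carrier)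
qed

lemma compact_nested_Int:
  fixes C :: "nat \<Rightarrow> 'a set"
  assumes "compactin T K" "\<And>n. closedin T (C n)" "\<And>n. K \<inter> C n \<noteq> {}" "\<And>n. C (Suc n) \<subseteq> C n"
  shows "K \<inter> (\<Inter>n. C n) \<noteq> {}"
proof -
  have K: "compact_space (subtopology T K)" "K \<subseteq> topspace T"
    using assms(1) by (auto simp: compactin_subspace)
  have "(\<Inter>n. K \<inter> C n) \<noteq> {}"
  proof (rule compact_space_imp_nest[OF K(1)])
    show "closedin (subtopology T K) (K \<inter> C n)" for n
      using assms(2) by (auto simp: closedin_subtopology)
    show "K \<inter> C n \<noteq> {}" for n by (rule assms(3))
    show "decseq (\<lambda>n. K \<inter> C n)" using assms(4) by (auto simp: decseq_Suc_iff)
  qed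
  then show ?thesis by auto
qed

end

section \<open>Continuous endomorphisms\<close>

locale tdlc_endo = tdlc_group G T for G :: "('a, 'b) monoid_scheme" (structure) and T +
  fixes \<alpha> :: "'a \<Rightarrow> 'a"
  assumes endo: "\<alpha> \<in> continuous_End G T"
begin

lemma continuous_map_iter: "continuous_map T T (\<alpha> ^^ n)"
proof (induction n)
  case 0
  then show ?case by (simp add: id_def)
next
  case (Suc n)
  have "continuous_map T T \<alpha>" using endo by (simp add: continuous_End_def)
  then show ?case unfolding funpow.simps by (rule continuous_map_compose[OF Suc])
qed

lemma hom_iter: "\<alpha> ^^ n \<in> hom G G"
proof (induction n)
  case 0
  then show ?case by (simp add: hom_def)
next
  case (Suc n)
  have "\<alpha> \<in> hom G G" using endo by (simp add: continuous_End_def)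
  with Suc show ?case by (auto simp: hom_def Pi_iff)
qed

lemma group_hom_iter: "group_hom G G (\<alpha> ^^ n)"
  by (simp add: group_hom_def group_hom_axioms_def hom_iter)

lemmas iter_closed [simp, intro] = group_hom.hom_closed[OF group_hom_iter]
lemmas iter_mult = group_hom.hom_mult[OF group_hom_iter]
lemmas iter_inv = group_hom.hom_inv[OF group_hom_iter]
lemmas iter_one = group_hom.hom_one[OF group_hom_iter]

lemmas \<alpha>_closed = iter_closed[of _ 1, simplified]
lemmas \<alpha>_mult = iter_mult[of _ _ 1, simplified]
lemmas \<alpha>_inv = iter_inv[of _ 1, simplified]

lemma mem_preimage_iter: "x \<in> preimage_iter G \<alpha> n A \<longleftrightarrow> x \<in> carrier G \<and> (\<alpha> ^^ n) x \<in> A"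
  by (simp add: preimage_iter_def)

lemma preimage_iter_add:
  "preimage_iter G \<alpha> m (preimage_iter G \<alpha> n A) = preimage_iter G \<alpha> (n + m) A"
  by (auto simp: preimage_iter_def funpow_add)

lemma subgroup_preimage_iter:
  assumes "subgroup H G"
  shows "subgroup (preimage_iter G \<alpha> n H) G"
  by (rule subgroup.intro)
     (auto simp: mem_preimage_iter iter_mult iter_one iter_inv subgroup.m_closed[OF assms]
       subgroup.one_closed[OF assms] subgroup.m_inv_closed[OF assms])

lemma openin_preimage_iter: "openin T A \<Longrightarrow> openin T (preimage_iter G \<alpha> n A)"
  using openin_continuous_map_preimage[OF continuous_map_iter]
  by (simp add: preimage_iter_def topspace_carrier)

lemma closedin_preimage_iter: "closedin T A \<Longrightarrow> closedin T (preimage_iter G \<alpha> n A)"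
  using closedin_continuous_map_preimage[OF continuous_map_iter]
  by (simp add: preimage_iter_def topspace_carrier)

lemma left_cosets_in_preimage_iter:
  assumes A: "A \<subseteq> carrier G" and B: "subgroup B G"
  shows "left_cosets_in G A (preimage_iter G \<alpha> n B) \<approx> left_cosets_in G ((\<alpha> ^^ n) ` A) B"
proof -
  have "(\<lambda>a. a <# preimage_iter G \<alpha> n B) ` A \<approx> (\<lambda>a. (\<alpha> ^^ n) a <# B) ` A"
  proof (rule image_eqpoll_image)
    fix a b assume "a \<in> A" "b \<in> A"
    then have "a \<in> carrier G" "b \<in> carrier G" using A by auto
    then show "a <# preimage_iter G \<alpha> n B = b <# preimage_iter G \<alpha> n B \<longleftrightarrow>
        (\<alpha> ^^ n) a <# B = (\<alpha> ^^ n) b <# B"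
      by (simp add: l_coset_eq_iff subgroup_preimage_iter B mem_preimage_iter iter_mult iter_inv)
  qed
  then show ?thesis by (simp add: left_cosets_in_def image_image)
qed

lemma rel_index_preimage_iter:
  assumes "A \<subseteq> carrier G" "subgroup B G"
  shows "rel_index G A (preimage_iter G \<alpha> n B) = rel_index G ((\<alpha> ^^ n) ` A) B"
  by (rule rel_index_eqpoll[OF left_cosets_in_preimage_iter[OF assms]])

end

section \<open>The subgroups attached to a compact open subgroup\<close>

locale tdlc_endo_subgroup = tdlc_endo G T \<alpha>
  for G :: "('a, 'b) monoid_scheme" (structure) and T and \<alpha> +
  fixes U :: "'a set"
  assumes compact_open_U: "compact_open U"
begin

abbreviation v :: "nat \<Rightarrow> 'a set" where
  "v i \<equiv> preimage_iter G \<alpha> i U"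

lemma subgroup_U: "subgroup U G" and compactin_U: "compactin T U" and openin_U: "openin T U"
  using compact_open_U by (auto simp: compact_open_subgroup_def)

lemmas closedin_U = compactin_closedin[OF compactin_U]
lemmas subgroup_v = subgroup_preimage_iter[OF subgroup_U]
lemmas openin_v = openin_preimage_iter[OF openin_U]
lemmas closedin_v = closedin_preimage_iter[OF closedin_U]

lemma U_carrier: "x \<in> U \<Longrightarrow> x \<in> carrier G"
  using subgroup.subset[OF subgroup_U] by blast

lemma compactin_Int_closed: "closedin T C \<Longrightarrow> compactin T (U \<inter> C)"
  using compactin_U closed_Int_compactin by (metis inf_commute)

lemma v_0: "v 0 = U"
  using U_carrier by (auto simp: preimage_iter_def)

lemma finite_cosets_v: "compactin T A \<Longrightarrow> finite (left_cosets_in G A (v n))"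
  by (rule finite_left_cosets_in[OF _ subgroup_v openin_v])

lemma mem_U_neg: "x \<in> U_neg G \<alpha> U n \<longleftrightarrow> x \<in> carrier G \<and> (\<forall>k\<le>n. (\<alpha> ^^ k) x \<in> U)"
  by (auto simp: U_neg_def preimage_iter_def)

lemma U_neg_0: "U_neg G \<alpha> U 0 = U"
  using U_carrier by (auto simp: mem_U_neg)

lemma U_neg_Suc: "U_neg G \<alpha> U (Suc n) = U_neg G \<alpha> U n \<inter> v (Suc n)"
  by (auto simp: mem_U_neg preimage_iter_def le_Suc_eq)

lemma mem_U_neg_Suc: "x \<in> U_neg G \<alpha> U (Suc n) \<longleftrightarrow> x \<in> U \<and> \<alpha> x \<in> U_neg G \<alpha> U n"
proof
  assume x: "x \<in> U_neg G \<alpha> U (Suc n)"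
  have "(\<alpha> ^^ k) (\<alpha> x) \<in> U" if "k \<le> n" for k
    using x that unfolding mem_U_neg by (metis Suc_le_mono comp_apply funpow_Suc_right)
  moreover have "x \<in> U" using x unfolding mem_U_neg by (metis funpow_0 le0)
  ultimately show "x \<in> U \<and> \<alpha> x \<in> U_neg G \<alpha> U n"
    using U_carrier \<alpha>_closed by (simp add: mem_U_neg)
next
  assume x: "x \<in> U \<and> \<alpha> x \<in> U_neg G \<alpha> U n"
  have "(\<alpha> ^^ k) x \<in> U" if "k \<le> Suc n" for k
    using that x by (cases k) (auto simp: mem_U_neg funpow_swap1)
  then show "x \<in> U_neg G \<alpha> U (Suc n)" using x U_carrier by (simp add: mem_U_neg)
qed

lemma U_neg_subset: "U_neg G \<alpha> U n \<subseteq> U"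
  by (auto simp: mem_U_neg) (metis funpow_0 le0)

lemma subgroup_U_neg: "subgroup (U_neg G \<alpha> U n) G"
  by (induction n) (auto simp: U_neg_0 U_neg_Suc subgroup_U subgroup_v subgroups_Inter_pair)

lemma closedin_U_neg: "closedin T (U_neg G \<alpha> U n)"
  by (induction n) (auto simp: U_neg_0 U_neg_Suc closedin_U closedin_v)

lemma compactin_U_neg: "compactin T (U_neg G \<alpha> U n)"
  using compactin_Int_closed[OF closedin_U_neg] U_neg_subset by (metis inf.absorb2)

lemma mem_U_minus: "x \<in> U_minus G \<alpha> U \<longleftrightarrow> x \<in> carrier G \<and> (\<forall>k. (\<alpha> ^^ k) x \<in> U)"
  by (auto simp: U_minus_def mem_U_neg)

lemma U_minus_subset: "U_minus G \<alpha> U \<subseteq> U"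
  by (auto simp: mem_U_minus) (metis funpow_0)

lemma subgroup_U_minus: "subgroup (U_minus G \<alpha> U) G"
  unfolding U_minus_def by (rule subgroups_Inter) (auto simp: subgroup_U_neg)

lemma closedin_U_minus: "closedin T (U_minus G \<alpha> U)"
  unfolding U_minus_def by (rule closedin_Inter) (auto simp: closedin_U_neg)

lemma U_pos_eq_image: "U_pos \<alpha> U n = (\<alpha> ^^ n) ` U_neg G \<alpha> U n"
proof (induction n)
  case 0
  then show ?case by (simp add: U_neg_0)
next
  case (Suc n)
  have "U_pos \<alpha> U (Suc n) = U \<inter> (\<alpha> ^^ Suc n) ` U_neg G \<alpha> U n"
    by (simp add: Suc image_image)
  also have "\<dots> = (\<alpha> ^^ Suc n) ` U_neg G \<alpha> U (Suc n)"
    by (auto simp: U_neg_Suc mem_preimage_iter mem_U_neg)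
  finally show ?case .
qed

lemma subgroup_U_pos: "subgroup (U_pos \<alpha> U n) G"
  unfolding U_pos_eq_image
  by (rule group_hom.subgroup_img_is_subgroup[OF group_hom_iter subgroup_U_neg])

lemma compactin_U_pos: "compactin T (U_pos \<alpha> U n)"
  unfolding U_pos_eq_image by (rule image_compactin[OF compactin_U_neg continuous_map_iter])

lemmas closedin_U_pos = compactin_closedin[OF compactin_U_pos]

lemma U_pos_decreasing: "U_pos \<alpha> U (Suc n) \<subseteq> U_pos \<alpha> U n"
  by (induction n) auto

lemma U_pos_subset: "U_pos \<alpha> U n \<subseteq> U"
  by (cases n) auto

lemma U_plus_subset: "U_plus \<alpha> U \<subseteq> U"
  using U_pos_subset by (auto simp: U_plus_def)

lemma subgroup_U_plus: "subgroup (U_plus \<alpha> U) G"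
  unfolding U_plus_def by (rule subgroups_Inter) (auto simp: subgroup_U_pos)

lemma closedin_U_plus: "closedin T (U_plus \<alpha> U)"
  unfolding U_plus_def by (rule closedin_Inter) (auto simp: closedin_U_pos)

lemma compactin_U_plus: "compactin T (U_plus \<alpha> U)"
  using compactin_Int_closed[OF closedin_U_plus] U_plus_subset by (metis inf.absorb2)

text \<open>The fibre of \<open>\<alpha>\<close> over a point of \<open>U\<^sub>+\<close> meets every \<open>U\<^sub>n\<close> in a compact set, hence by nesting
  it meets their intersection.\<close>

lemma U_plus_lift:
  assumes "p \<in> U_plus \<alpha> U"
  shows "\<exists>q \<in> U_plus \<alpha> U. \<alpha> q = p"
proof -
  have pU: "p \<in> U" using assms U_plus_subset by blast
  have "closedin T {p}"
    using Hausdorff pU U_carrier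
    by (simp add: closedin_Hausdorff_sing_eq topspace_carrier)
  then have cl: "closedin T (preimage_iter G \<alpha> 1 {p})" by (rule closedin_preimage_iter)
  let ?K = "U \<inter> preimage_iter G \<alpha> 1 {p}"
  have "?K \<inter> (\<Inter>n. U_pos \<alpha> U n) \<noteq> {}"
  proof (rule compact_nested_Int)
    show "compactin T ?K" by (rule compactin_Int_closed[OF cl])
    show "closedin T (U_pos \<alpha> U n)" "U_pos \<alpha> U (Suc n) \<subseteq> U_pos \<alpha> U n" for n
      by (fact closedin_U_pos U_pos_decreasing)+
    fix n
    have "p \<in> U_pos \<alpha> U (Suc n)" using assms by (auto simp: U_plus_def simp del: U_pos.simps)
    then obtain q where "q \<in> U_pos \<alpha> U n" "p = \<alpha> q" by auto
    then have "q \<in> ?K \<inter> U_pos \<alpha> U n"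
      using U_pos_subset U_carrier by (auto simp: mem_preimage_iter)
    then show "?K \<inter> U_pos \<alpha> U n \<noteq> {}" by blast
  qed
  then show ?thesis by (auto simp: U_plus_def mem_preimage_iter)
qed

lemma U_plus_lift_iter:
  assumes "p \<in> U_plus \<alpha> U"
  shows "\<exists>q. (\<forall>k\<le>n. (\<alpha> ^^ k) q \<in> U_plus \<alpha> U) \<and> (\<alpha> ^^ n) q = p"
proof (induction n)
  case 0
  then show ?case using assms by auto
next
  case (Suc n)
  then obtain q where q: "\<forall>k\<le>n. (\<alpha> ^^ k) q \<in> U_plus \<alpha> U" "(\<alpha> ^^ n) q = p" by blast
  then have "q \<in> U_plus \<alpha> U" by (metis funpow_0 le0)
  then obtain r where r: "r \<in> U_plus \<alpha> U" "\<alpha> r = q" using U_plus_lift by blast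
  have "(\<alpha> ^^ k) r \<in> U_plus \<alpha> U" if "k \<le> Suc n" for k
    using that q r by (cases k) (auto simp: funpow_swap1)
  moreover have "(\<alpha> ^^ Suc n) r = p" using q r by (simp add: funpow_swap1)
  ultimately show ?case by blast
qed

end

context tdlc_endo_subgroup
begin

section \<open>Tidiness above\<close>

text \<open>The map \<open>\<alpha>\<^sup>n\<close> carries \<open>U\<^sub>-\<^sub>n\<close> onto \<open>U\<^sub>n\<close> and \<open>\<alpha>\<^sup>-\<^sup>n\<^sup>-\<^sup>1(U)\<close> is the full preimage of
  \<open>\<alpha>\<^sup>-\<^sup>1(U)\<close> under it.  All indices are thereby computed with cosets of the one group
  \<open>\<alpha>\<^sup>-\<^sup>1(U)\<close>, where they can be compared.\<close>

lemma U_neg_index_step: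
  "rel_index G (U_neg G \<alpha> U n) (v (Suc n)) = rel_index G (U_pos \<alpha> U n) (v 1)"
proof -
  have "U_neg G \<alpha> U n \<subseteq> carrier G" using U_neg_subset U_carrier by blast
  from rel_index_preimage_iter[OF this subgroup_v, of n 1]
  show ?thesis by (simp add: preimage_iter_add U_pos_eq_image)
qed

lemma U_neg_index_step_le:
  "rel_index G (U_neg G \<alpha> U n) (v (Suc n)) \<le> rel_index G U (v 1)"
  unfolding U_neg_index_step
  by (rule rel_index_mono_left[OF U_pos_subset finite_cosets_v[OF compactin_U]])

text \<open>If \<open>\<alpha>(x) \<in> pU\<^sub>-\<^sub>n\<close> with \<open>p \<in> U\<^sub>+\<close> and \<open>q \<in> U\<^sub>+\<close> lifts \<open>p\<close>, then \<open>x \<in> qU\<^sub>-\<^sub>n\<^sub>-\<^sub>1\<close> for every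
  \<open>x \<in> U\<close>.  So a factorisation modulo \<open>\<alpha>\<^sup>-\<^sup>1(U)\<close>, which provides elements \<open>x\<close> with
  \<open>\<alpha>(x) \<in> U\<close>, can be refined step by step.\<close>

lemma U_plus_factor_U_neg:
  assumes base: "\<And>u. u \<in> U \<Longrightarrow> \<exists>p \<in> U_plus \<alpha> U. inv p \<otimes> u \<in> v 1"
  shows "u \<in> U \<Longrightarrow> \<exists>p \<in> U_plus \<alpha> U. inv p \<otimes> u \<in> U_neg G \<alpha> U n"
proof (induction n arbitrary: u)
  case 0
  then show ?case
    using subgroup.one_closed[OF subgroup_U_plus] U_carrier by (intro bexI[of _ \<one>]) (auto simp: U_neg_0)
next
  case (Suc n)
  obtain p0 where p0: "p0 \<in> U_plus \<alpha> U" "inv p0 \<otimes> u \<in> v 1" using base[OF Suc.prems] by blast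
  define x where "x = inv p0 \<otimes> u"
  have p0U: "p0 \<in> U" using p0 U_plus_subset by blast
  have x: "x \<in> U" "\<alpha> x \<in> U"
    using p0 p0U Suc.prems subgroup.m_closed[OF subgroup_U] subgroup.m_inv_closed[OF subgroup_U]
    by (auto simp: x_def mem_preimage_iter)
  obtain p where p: "p \<in> U_plus \<alpha> U" "inv p \<otimes> \<alpha> x \<in> U_neg G \<alpha> U n" using Suc.IH[OF x(2)] by blast
  obtain q where q: "q \<in> U_plus \<alpha> U" "\<alpha> q = p" using U_plus_lift[OF p(1)] by blast
  have qU: "q \<in> U" using q U_plus_subset by blast
  have qx: "inv q \<otimes> x \<in> U"
    using qU x subgroup.m_closed[OF subgroup_U] subgroup.m_inv_closed[OF subgroup_U] by blast
  have "\<alpha> (inv q \<otimes> x) = inv p \<otimes> \<alpha> x"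
    using qU x U_carrier q by (simp add: \<alpha>_mult \<alpha>_inv)
  then have "inv q \<otimes> x \<in> U_neg G \<alpha> U (Suc n)" using qx p by (simp add: mem_U_neg_Suc)
  moreover have "inv q \<otimes> x = inv (p0 \<otimes> q) \<otimes> u"
    using p0U qU Suc.prems U_carrier by (simp add: x_def inv_mult_group m_assoc)
  ultimately show ?case using subgroup.m_closed[OF subgroup_U_plus p0(1) q(1)] by metis
qed

text \<open>Since \<open>[U\<^sub>-\<^sub>n : U\<^sub>-\<^sub>n\<^sub>-\<^sub>1] = [U\<^sub>n : U\<^sub>n \<inter> \<alpha>\<^sup>-\<^sup>1(U)]\<close>, constancy of these indices says that
  \<open>U = U\<^sub>n (U \<inter> \<alpha>\<^sup>-\<^sup>1(U))\<close> for every \<open>n\<close>; compactness replaces \<open>U\<^sub>n\<close> by \<open>U\<^sub>+\<close>, lifting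
  replaces \<open>\<alpha>\<^sup>-\<^sup>1(U)\<close> by \<open>U\<^sub>-\<^sub>n\<close>, and compactness again replaces that by \<open>U\<^sub>-\<close>.\<close>

theorem tidy_above_iff_index:
  "tidy_above G \<alpha> U \<longleftrightarrow>
    (\<forall>n. rel_index G (U_neg G \<alpha> U n) (v (Suc n)) = rel_index G U (v 1))"
proof
  assume tidy: "tidy_above G \<alpha> U"
  show "\<forall>n. rel_index G (U_neg G \<alpha> U n) (v (Suc n)) = rel_index G U (v 1)"
  proof
    fix n
    have "left_cosets_in G U (v 1) \<subseteq> left_cosets_in G (U_pos \<alpha> U n) (v 1)"
    proof
      fix X assume "X \<in> left_cosets_in G U (v 1)"
      then obtain u where u: "u \<in> U" "X = u <# v 1" by (auto simp: left_cosets_in_def)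
      then obtain p m where pm: "p \<in> U_plus \<alpha> U" "m \<in> U_minus G \<alpha> U" "u = p \<otimes> m"
        using tidy unfolding tidy_above_def set_mult_def by blast
      have pU: "p \<in> U" "p \<in> U_pos \<alpha> U n" using pm(1) U_plus_subset by (auto simp: U_plus_def)
      have mc: "m \<in> carrier G" and "m \<in> v 1"
        using pm(2) unfolding mem_U_minus mem_preimage_iter by blast+
      then have "inv p \<otimes> u \<in> v 1" using pm U_carrier[OF pU(1)] by (simp add: m_assoc[symmetric])
      then have "p <# v 1 = X"
        using u pU U_carrier by (simp add: l_coset_eq_iff[OF subgroup_v])
      then show "X \<in> left_cosets_in G (U_pos \<alpha> U n) (v 1)"
        using pU by (auto simp: left_cosets_in_def)
    qed
    moreover have "left_cosets_in G (U_pos \<alpha> U n) (v 1) \<subseteq> left_cosets_in G U (v 1)"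
      using U_pos_subset unfolding left_cosets_in_def by (rule image_mono)
    ultimately have "left_cosets_in G (U_pos \<alpha> U n) (v 1) = left_cosets_in G U (v 1)" by blast
    then show "rel_index G (U_neg G \<alpha> U n) (v (Suc n)) = rel_index G U (v 1)"
      by (subst U_neg_index_step) (simp add: rel_index_def)
  qed
next
  assume "\<forall>n. rel_index G (U_neg G \<alpha> U n) (v (Suc n)) = rel_index G U (v 1)"
  then have idx: "rel_index G (U_pos \<alpha> U n) (v 1) = rel_index G U (v 1)" for n
    by (simp add: U_neg_index_step)
  have sub: "left_cosets_in G (U_pos \<alpha> U n) (v 1) \<subseteq> left_cosets_in G U (v 1)" for n
    using U_pos_subset unfolding left_cosets_in_def by (rule image_mono)
  (* a finite set has no proper subset of the same size: U = U_n (U \<inter> v 1) *)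
  have eq: "left_cosets_in G (U_pos \<alpha> U n) (v 1) = left_cosets_in G U (v 1)" for n
    using card_subset_eq[OF finite_cosets_v[OF compactin_U] sub] idx by (simp add: rel_index_def)
  have cl: "closedin T {p \<in> topspace T. inv p \<otimes> u \<in> C}"
    if "u \<in> U" "closedin T C" for u C
    by (rule closedin_continuous_map_preimage[OF continuous_map_mult that(2)])
       (auto intro: continuous_map_inv simp: U_carrier[OF that(1)] topspace_carrier)
  have base: "\<exists>p \<in> U_plus \<alpha> U. inv p \<otimes> u \<in> v 1" if u: "u \<in> U" for u
  proof -
    let ?C = "\<lambda>n. U_pos \<alpha> U n \<inter> {p \<in> topspace T. inv p \<otimes> u \<in> v 1}"
    have "U \<inter> (\<Inter>n. ?C n) \<noteq> {}"
    proof (rule compact_nested_Int[OF compactin_U])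
      show "closedin T (?C n)" for n
        using cl[OF u closedin_v] closedin_U_pos by blast
      show "?C (Suc n) \<subseteq> ?C n" for n using U_pos_decreasing by blast
      fix n
      have "u <# v 1 \<in> left_cosets_in G (U_pos \<alpha> U n) (v 1)"
        unfolding eq using u by (auto simp: left_cosets_in_def)
      then obtain p where p: "p \<in> U_pos \<alpha> U n" "p <# v 1 = u <# v 1"
        by (auto simp: left_cosets_in_def)
      then have "p \<in> U" using U_pos_subset by blast
      then have "p \<in> U \<inter> ?C n"
        using p u U_carrier by (simp add: topspace_carrier l_coset_eq_iff[OF subgroup_v])
      then show "U \<inter> ?C n \<noteq> {}" by blast
    qed
    then show ?thesis by (auto simp: U_plus_def)
  qed
  have "U \<subseteq> U_plus \<alpha> U <#> U_minus G \<alpha> U"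
  proof
    fix u assume u: "u \<in> U"
    let ?C = "\<lambda>n. {p \<in> topspace T. inv p \<otimes> u \<in> U_neg G \<alpha> U n}"
    have "U_plus \<alpha> U \<inter> (\<Inter>n. ?C n) \<noteq> {}"
    proof (rule compact_nested_Int[OF compactin_U_plus])
      show "closedin T (?C n)" for n by (rule cl[OF u closedin_U_neg])
      show "?C (Suc n) \<subseteq> ?C n" for n by (auto simp: U_neg_Suc)
      show "U_plus \<alpha> U \<inter> ?C n \<noteq> {}" for n
        using U_plus_factor_U_neg[OF base u, of n] U_plus_subset U_carrier
        by (auto simp: topspace_carrier)
    qed
    then obtain p where p: "p \<in> U_plus \<alpha> U" "inv p \<otimes> u \<in> U_minus G \<alpha> U"
      by (auto simp: U_minus_def)
    then have "p \<in> carrier G" using U_plus_subset U_carrier by blast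
    then have "u = p \<otimes> (inv p \<otimes> u)" using U_carrier[OF u] by (simp add: m_assoc[symmetric])
    then show "u \<in> U_plus \<alpha> U <#> U_minus G \<alpha> U" using p unfolding set_mult_def by blast
  qed
  moreover have "U_plus \<alpha> U <#> U_minus G \<alpha> U \<subseteq> U"
    using U_plus_subset U_minus_subset subgroup.m_closed[OF subgroup_U]
    unfolding set_mult_def by blast
  ultimately show "tidy_above G \<alpha> U" unfolding tidy_above_def by (rule subset_antisym)
qed

section \<open>Tidiness below\<close>

lemma mem_U_minus_minus:
  "x \<in> U_minus_minus G \<alpha> U \<longleftrightarrow> x \<in> carrier G \<and> (\<exists>n. (\<alpha> ^^ n) x \<in> U_minus G \<alpha> U)"
  by (auto simp: U_minus_minus_def mem_preimage_iter)

lemma U_minus_subset_U_minus_minus: "U_minus G \<alpha> U \<subseteq> U_minus_minus G \<alpha> U"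
proof
  fix x assume "x \<in> U_minus G \<alpha> U"
  then have "x \<in> carrier G" "(\<alpha> ^^ 0) x \<in> U_minus G \<alpha> U" by (simp_all add: mem_U_minus)
  then show "x \<in> U_minus_minus G \<alpha> U" unfolding mem_U_minus_minus by blast
qed

lemma iter_U_minus:
  assumes "(\<alpha> ^^ n) x \<in> U_minus G \<alpha> U" "n \<le> m"
  shows "(\<alpha> ^^ m) x \<in> U_minus G \<alpha> U"
proof -
  obtain k where m: "m = k + n" using assms(2) by (metis le_iff_add add.commute)
  have "(\<alpha> ^^ j) ((\<alpha> ^^ k) ((\<alpha> ^^ n) x)) \<in> U" for j
    using assms(1) unfolding mem_U_minus by (metis comp_apply funpow_add)
  then show ?thesis using assms(1) by (simp add: m funpow_add mem_U_minus)
qed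

lemma subgroup_U_minus_minus: "subgroup (U_minus_minus G \<alpha> U) G"
proof (rule subgroup.intro)
  show "U_minus_minus G \<alpha> U \<subseteq> carrier G" by (auto simp: mem_U_minus_minus)
  show "\<one> \<in> U_minus_minus G \<alpha> U"
    using subgroup.one_closed[OF subgroup_U_minus] by (auto simp: mem_U_minus_minus intro: exI[of _ 0])
  fix x y assume x: "x \<in> U_minus_minus G \<alpha> U"
  then obtain n where n: "x \<in> carrier G" "(\<alpha> ^^ n) x \<in> U_minus G \<alpha> U" by (auto simp: mem_U_minus_minus)
  then show "inv x \<in> U_minus_minus G \<alpha> U"
    using subgroup.m_inv_closed[OF subgroup_U_minus] by (auto simp: mem_U_minus_minus iter_inv)
  assume "y \<in> U_minus_minus G \<alpha> U"
  then obtain m where m: "y \<in> carrier G" "(\<alpha> ^^ m) y \<in> U_minus G \<alpha> U" by (auto simp: mem_U_minus_minus)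
  have "(\<alpha> ^^ max n m) (x \<otimes> y) \<in> U_minus G \<alpha> U"
    using n m iter_U_minus[OF n(2), of "max n m"] iter_U_minus[OF m(2), of "max n m"]
    by (simp add: iter_mult subgroup.m_closed[OF subgroup_U_minus])
  then show "x \<otimes> y \<in> U_minus_minus G \<alpha> U" using n m by (auto simp: mem_U_minus_minus)
qed

lemma U_Int_v_imp_U_neg:
  assumes "\<And>i. U \<inter> v (Suc i) \<subseteq> v i"
  shows "U \<inter> v n = U_neg G \<alpha> U n"
proof (induction n)
  case 0
  then show ?case by (simp add: v_0 U_neg_0)
next
  case (Suc n)
  then show ?case using assms[of n] by (auto simp: U_neg_Suc)
qed

text \<open>An element of \<open>U\<^sub>-\<^sub>- \<inter> U\<close> lies in \<open>U \<inter> \<alpha>\<^sup>-\<^sup>m(U) = U\<^sub>-\<^sub>m\<close> for all large \<open>m\<close>, hence in \<open>U\<^sub>-\<close>.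
  So \<open>U\<^sub>-\<^sub>-\<close> meets the open group \<open>U\<close> in a closed set.\<close>

lemma tidy_belowI:
  assumes "\<And>i. U \<inter> v (Suc i) \<subseteq> v i"
  shows "tidy_below G T \<alpha> U"
proof -
  have "U_minus_minus G \<alpha> U \<inter> U = U_minus G \<alpha> U"
  proof
    show "U_minus G \<alpha> U \<subseteq> U_minus_minus G \<alpha> U \<inter> U"
      using U_minus_subset U_minus_subset_U_minus_minus by blast
    show "U_minus_minus G \<alpha> U \<inter> U \<subseteq> U_minus G \<alpha> U"
    proof clarify
      fix x assume x: "x \<in> U_minus_minus G \<alpha> U" "x \<in> U"
      then obtain n where n: "(\<alpha> ^^ n) x \<in> U_minus G \<alpha> U" by (auto simp: mem_U_minus_minus)
      have "(\<alpha> ^^ k) x \<in> U" for k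
      proof -
        have "(\<alpha> ^^ max n k) x \<in> U" using iter_U_minus[OF n, of "max n k"] U_minus_subset by auto
        then have "x \<in> U_neg G \<alpha> U (max n k)"
          using x U_carrier U_Int_v_imp_U_neg[OF assms, of "max n k"] by (auto simp: mem_preimage_iter)
        then show ?thesis by (simp add: mem_U_neg)
      qed
      then show "x \<in> U_minus G \<alpha> U" using x U_carrier by (simp add: mem_U_minus)
    qed
  qed
  then have "closedin T (U_minus_minus G \<alpha> U \<inter> U)" using closedin_U_minus by simp
  then show ?thesis
    unfolding tidy_below_def
    by (rule locally_closed_subgroup_closed[OF subgroup_U_minus_minus subgroup_U openin_U])
qed

text \<open>By Baire's theorem one of the increasing closed subgroups \<open>\<alpha>\<^sup>-\<^sup>n(U\<^sub>-) \<inter> U\<close>, whose union is the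
  compact group \<open>U\<^sub>-\<^sub>- \<inter> U\<close>, is open in it; finitely many of its cosets cover, so the union is
  already reached at a finite stage.\<close>

lemma U_minus_minus_Int_uniform:
  assumes "tidy_below G T \<alpha> U"
  shows "\<exists>N. \<forall>x \<in> U_minus_minus G \<alpha> U \<inter> U. (\<alpha> ^^ N) x \<in> U_minus G \<alpha> U"
proof -
  define K where "K = U_minus_minus G \<alpha> U \<inter> U"
  define H where "H n = K \<inter> preimage_iter G \<alpha> n (U_minus G \<alpha> U)" for n
  have K_comp: "compactin T K"
    using compactin_Int_closed assms unfolding K_def tidy_below_def by (metis inf_commute)
  have K_sub: "subgroup K G" unfolding K_def by (rule subgroups_Inter_pair[OF subgroup_U_minus_minus subgroup_U])
  have H_sub: "subgroup (H n) G" for n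
    unfolding H_def by (intro subgroups_Inter_pair K_sub subgroup_preimage_iter subgroup_U_minus)
  have Kc: "x \<in> carrier G" if "x \<in> K" for x using that U_carrier by (auto simp: K_def)
  have K_UN: "K = (\<Union>n. H n)" using Kc by (auto simp: H_def K_def mem_U_minus_minus mem_preimage_iter)
  let ?X = "subtopology T K"
  have KT: "K \<subseteq> topspace T" using Kc by (auto simp: topspace_carrier)
  have comp: "compact_space ?X" using K_comp by (simp add: compactin_subspace)
  have haus: "Hausdorff_space ?X" by (simp add: Hausdorff Hausdorff_space_subtopology)
  have cl: "closedin ?X (H n)" for n
    using closedin_preimage_iter[OF closedin_U_minus] by (auto simp: H_def closedin_subtopology)
  have "\<exists>n. ?X interior_of (H n) \<noteq> {}"
  proof (rule ccontr)
    assume "\<nexists>n. ?X interior_of (H n) \<noteq> {}"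
    then have "?X interior_of (\<Union> (range H)) = {}"
      using comp haus cl
      by (intro Baire_category_alt)
         (auto intro: compact_imp_locally_compact_space compact_Hausdorff_imp_regular_space)
    then have "?X interior_of K = {}" using K_UN by simp
    moreover have "?X interior_of K = K" using KT by (metis inf.absorb2 interior_of_topspace topspace_subtopology)
    ultimately show False using subgroup.one_closed[OF K_sub] by simp
  qed
  then obtain n h where h: "h \<in> ?X interior_of (H n)" by blast
  then obtain P where P: "openin T P" "h \<in> P" "K \<inter> P \<subseteq> H n" "h \<in> K"
    unfolding interior_of_def by (auto simp: openin_subtopology)
  (* translates of the interior point h to each k in K *)
  let ?\<C> = "(\<lambda>k. (k \<otimes> inv h) <# P) ` K"
  have Pc: "P \<subseteq> carrier G" using openin_subset[OF P(1)] by (simp add: topspace_carrier)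
  have "openin T Y" if "Y \<in> ?\<C>" for Y
    using that openin_l_coset[OF P(1)] Kc P(4) by auto
  moreover have "K \<subseteq> \<Union>?\<C>"
  proof
    fix k assume k: "k \<in> K"
    then have "k \<in> (k \<otimes> inv h) <# P"
      using Kc P by (simp add: l_coset_mem_iff[OF Pc] inv_mult_group m_assoc)
    then show "k \<in> \<Union>?\<C>" using k by blast
  qed
  ultimately obtain \<F> where F: "finite \<F>" "\<F> \<subseteq> ?\<C>" "K \<subseteq> \<Union>\<F>"
    using compactinD[OF K_comp, of ?\<C>] by auto
  obtain E where E: "finite E" "E \<subseteq> K" "\<F> = (\<lambda>k. (k \<otimes> inv h) <# P) ` E"
    using finite_subset_image[OF F(1,2)] by blast
  have "\<exists>m. (\<alpha> ^^ m) k \<in> U_minus G \<alpha> U" if "k \<in> E" for k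
    using that E by (auto simp: K_def mem_U_minus_minus)
  then obtain f where f: "(\<alpha> ^^ f k) k \<in> U_minus G \<alpha> U" if "k \<in> E" for k by metis
  define N where "N = Max (insert n (f ` E))"
  have "(\<alpha> ^^ N) x \<in> U_minus G \<alpha> U" if x: "x \<in> K" for x
  proof -
    obtain Y where Y: "Y \<in> \<F>" "x \<in> Y" using x F(3) by auto
    then obtain k where k: "k \<in> E" "x \<in> (k \<otimes> inv h) <# P" using E(3) by auto
    have kK: "k \<in> K" using k E by blast
    let ?y = "inv (k \<otimes> inv h) \<otimes> x"
    have y: "?y \<in> P" using k(2) l_coset_mem_iff[OF Pc, of "k \<otimes> inv h" x] Kc kK P(4) by simp
    have "k \<otimes> inv h \<in> K"
      using subgroup.m_closed[OF K_sub] subgroup.m_inv_closed[OF K_sub] kK P(4) by blast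
    then have "?y \<in> K"
      using subgroup.m_closed[OF K_sub] subgroup.m_inv_closed[OF K_sub] x by blast
    then have yH: "?y \<in> H n" using y P(3) by blast
    have hH: "h \<in> H n" using P by blast
    have "inv h \<otimes> ?y \<in> H n"
      using subgroup.m_closed[OF H_sub] subgroup.m_inv_closed[OF H_sub] yH hH by blast
    then have z: "(\<alpha> ^^ n) (inv h \<otimes> ?y) \<in> U_minus G \<alpha> U" by (simp add: H_def mem_preimage_iter)
    have nN: "n \<le> N" "f k \<le> N" using E(1) k(1) by (auto simp: N_def)
    have "x = k \<otimes> (inv h \<otimes> ?y)"
      using Kc x kK P(4) by (simp add: inv_mult_group m_assoc) (simp add: m_assoc[symmetric])
    then have "(\<alpha> ^^ N) x = (\<alpha> ^^ N) k \<otimes> (\<alpha> ^^ N) (inv h \<otimes> ?y)"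
      using iter_mult[of k "inv h \<otimes> ?y" N] Kc x kK P(4) by simp
    then show ?thesis
      using iter_U_minus[OF f[OF k(1)] nN(2)] iter_U_minus[OF z nN(1)]
        subgroup.m_closed[OF subgroup_U_minus] by simp
  qed
  then show ?thesis unfolding K_def by blast
qed

text \<open>Factoring \<open>x = pm\<close> along \<open>U = U\<^sub>+U\<^sub>-\<close> leaves \<open>p \<in> U\<^sub>+ \<inter> U\<^sub>-\<^sub>-\<close>.  An \<open>N\<close>-fold preimage \<open>q\<close> of \<open>p\<close> in
  \<open>U\<^sub>+\<close> is again in \<open>U\<^sub>-\<^sub>- \<inter> U\<close>, and the uniform \<open>N\<close> brings \<open>p = \<alpha>\<^sup>N(q)\<close> into \<open>U\<^sub>-\<close>.\<close>

lemma tidy_U_minus_minus_Int: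
  assumes "tidy G T \<alpha> U" "x \<in> U_minus_minus G \<alpha> U" "x \<in> U"
  shows "x \<in> U_minus G \<alpha> U"
proof -
  obtain N where N: "\<And>y. y \<in> U_minus_minus G \<alpha> U \<Longrightarrow> y \<in> U \<Longrightarrow> (\<alpha> ^^ N) y \<in> U_minus G \<alpha> U"
    using U_minus_minus_Int_uniform assms(1) unfolding tidy_def by blast
  obtain p m where pm: "p \<in> U_plus \<alpha> U" "m \<in> U_minus G \<alpha> U" "x = p \<otimes> m"
    using assms unfolding tidy_def tidy_above_def set_mult_def by blast
  have mm: "m \<in> U_minus_minus G \<alpha> U"
    using pm(2) U_minus_subset_U_minus_minus by blast
  have c: "p \<in> carrier G" "m \<in> carrier G"
    using pm U_plus_subset U_minus_subset U_carrier by blast+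
  have "p = x \<otimes> inv m" using pm c by (simp add: m_assoc)
  then have p_mm: "p \<in> U_minus_minus G \<alpha> U"
    using assms(2) mm subgroup.m_closed[OF subgroup_U_minus_minus]
      subgroup.m_inv_closed[OF subgroup_U_minus_minus] by blast
  obtain q where q: "\<forall>k\<le>N. (\<alpha> ^^ k) q \<in> U_plus \<alpha> U" "(\<alpha> ^^ N) q = p"
    using U_plus_lift_iter[OF pm(1)] by blast
  have qU: "q \<in> U" using q(1) U_plus_subset by (metis funpow_0 le0 subsetD)
  obtain n where "(\<alpha> ^^ n) p \<in> U_minus G \<alpha> U" using p_mm by (auto simp: mem_U_minus_minus)
  then have "(\<alpha> ^^ (n + N)) q \<in> U_minus G \<alpha> U" using q(2) by (simp add: funpow_add)
  then have "q \<in> U_minus_minus G \<alpha> U" using qU U_carrier by (auto simp: mem_U_minus_minus)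
  then have "p \<in> U_minus G \<alpha> U" using N qU q(2) by blast
  then show ?thesis using pm subgroup.m_closed[OF subgroup_U_minus] by blast
qed

text \<open>Let \<open>n = i + 1\<close> and \<open>\<alpha>\<^sup>n(x) = pm\<close> with \<open>p \<in> U\<^sub>+\<close>, \<open>m \<in> U\<^sub>-\<close>.  Dividing \<open>x\<close> by an \<open>n\<close>-fold preimage
  \<open>q\<close> of \<open>p\<close> whose orbit stays in \<open>U\<close> gives an element of \<open>U\<^sub>-\<^sub>- \<inter> U = U\<^sub>-\<close>, so the orbits of \<open>x\<close> and
  \<open>q\<close> leave \<open>U\<close> together, and that of \<open>q\<close> does not before time \<open>n\<close>.\<close>

lemma tidy_U_Int_v_subset:
  assumes tidy: "tidy G T \<alpha> U"
  shows "U \<inter> v (Suc i) \<subseteq> v i"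
proof clarify
  fix x assume x: "x \<in> U" "x \<in> v (Suc i)"
  let ?n = "Suc i"
  have xc: "x \<in> carrier G" using x U_carrier by blast
  obtain p m where pm: "p \<in> U_plus \<alpha> U" "m \<in> U_minus G \<alpha> U" "(\<alpha> ^^ ?n) x = p \<otimes> m"
    using x tidy unfolding tidy_def tidy_above_def set_mult_def mem_preimage_iter by blast
  obtain q where q: "\<forall>k\<le>?n. (\<alpha> ^^ k) q \<in> U_plus \<alpha> U" "(\<alpha> ^^ ?n) q = p"
    using U_plus_lift_iter[OF pm(1)] by blast
  have qU: "(\<alpha> ^^ k) q \<in> U" if "k \<le> ?n" for k using q(1) that U_plus_subset by blast
  have q0: "q \<in> U" using qU[of 0] by simp
  have qc: "q \<in> carrier G" using q0 U_carrier by blast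
  let ?y = "inv q \<otimes> x"
  have yU: "?y \<in> U"
    using q0 x subgroup.m_closed[OF subgroup_U] subgroup.m_inv_closed[OF subgroup_U] by blast
  have c: "p \<in> carrier G" "m \<in> carrier G"
    using pm U_plus_subset U_minus_subset U_carrier by blast+
  have "(\<alpha> ^^ ?n) ?y = inv p \<otimes> (p \<otimes> m)"
    using pm(3) q(2) qc xc by (simp only: iter_mult iter_inv inv_closed)
  also have "\<dots> = m" using c by (simp add: m_assoc[symmetric])
  finally have "?y \<in> U_minus_minus G \<alpha> U"
    using pm(2) qc xc unfolding mem_U_minus_minus by (metis inv_closed m_closed)
  then have "?y \<in> U_minus G \<alpha> U" using tidy_U_minus_minus_Int[OF tidy] yU by blast
  then have "(\<alpha> ^^ i) ?y \<in> U" by (simp add: mem_U_minus)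
  then have "(\<alpha> ^^ i) q \<otimes> (\<alpha> ^^ i) ?y \<in> U"
    using subgroup.m_closed[OF subgroup_U qU] by simp
  moreover have "(\<alpha> ^^ i) q \<otimes> (\<alpha> ^^ i) ?y = (\<alpha> ^^ i) x"
    using qc xc by (simp add: iter_mult iter_inv m_assoc[symmetric])
  ultimately show "x \<in> v i" using xc by (simp add: mem_preimage_iter)
qed

theorem tidy_iff:
  "tidy G T \<alpha> U \<longleftrightarrow>
    (\<forall>i. U \<inter> v (Suc i) \<subseteq> v i) \<and>
    (\<forall>i. rel_index G (U \<inter> v i) (v (Suc i)) = rel_index G U (v 1))"
proof -
  have "tidy G T \<alpha> U \<longleftrightarrow> (\<forall>i. U \<inter> v (Suc i) \<subseteq> v i) \<and> tidy_above G \<alpha> U"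
    using tidy_U_Int_v_subset tidy_belowI unfolding tidy_def by blast
  then show ?thesis
    using U_Int_v_imp_U_neg by (auto simp: tidy_above_iff_index)
qed

end

section \<open>The scale of an endomorphism with a tidy subgroup\<close>

context tdlc_endo_subgroup
begin

lemma subgroup_index_eq: "subgroup_index G (\<alpha> ` U) (U \<inter> \<alpha> ` U) = rel_index G U (v 1)"
proof -
  have img: "subgroup (\<alpha> ` U) G"
    using group_hom.subgroup_img_is_subgroup[OF group_hom_iter subgroup_U, of 1] by simp
  have "subgroup_index G (\<alpha> ` U) (U \<inter> \<alpha> ` U) = rel_index G (\<alpha> ` U) (\<alpha> ` U \<inter> U)"
    unfolding subgroup_index_def rel_index_def LCOSETS_def left_cosets_in_def
    by (simp add: Int_commute UNION_singleton_eq_range)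
  also have "\<dots> = rel_index G (\<alpha> ` U) U" by (rule rel_index_Int_absorb[OF img subgroup_U])
  also have "\<dots> = rel_index G U (v 1)"
    using rel_index_preimage_iter[OF subgroup.subset[OF subgroup_U] subgroup_U, of 1] by simp
  finally show ?thesis .
qed

lemma rel_index_U_v_pos: "rel_index G U (v n) > 0"
  using rel_index_pos[OF compactin_U _ subgroup_v openin_v] subgroup.one_closed[OF subgroup_U] by blast

lemma openin_U_neg: "openin T (U_neg G \<alpha> U n)"
  by (induction n) (auto simp: U_neg_0 U_neg_Suc openin_U openin_v)

lemma rel_index_U_neg_Suc:
  "rel_index G U (U_neg G \<alpha> U (Suc n)) =
    rel_index G U (U_neg G \<alpha> U n) * rel_index G (U_neg G \<alpha> U n) (v (Suc n))"
  using rel_index_Int[OF subgroup_U subgroup_U_neg subgroup_v, of n "Suc n"]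
  by (simp add: U_neg_Suc Int_absorb1[OF U_neg_subset])

lemma rel_index_U_neg_0: "rel_index G U (U_neg G \<alpha> U 0) = 1"
  using rel_index_eq_1[OF subgroup_U] subgroup.one_closed[OF subgroup_U] by (auto simp: U_neg_0)

text \<open>The chain \<open>U \<ge> U\<^sub>-\<^sub>1 \<ge> \<dots> \<ge> U\<^sub>-\<^sub>n\<close> ends inside \<open>\<alpha>\<^sup>-\<^sup>n(U)\<close>, and each of its \<open>n\<close> steps has
  index at most that of the first.\<close>

lemma rel_index_v_le: "rel_index G U (v n) \<le> rel_index G U (v 1) ^ n"
proof -
  have "rel_index G U (v n) \<le> rel_index G U (U_neg G \<alpha> U n)"
  proof (rule rel_index_antimono_right[OF subgroup_U_neg subgroup_v subgroup.subset[OF subgroup_U]])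
    show "U_neg G \<alpha> U n \<subseteq> v n" by (auto simp: mem_U_neg mem_preimage_iter)
    show "finite (left_cosets_in G U (U_neg G \<alpha> U n))"
      by (rule finite_left_cosets_in[OF compactin_U subgroup_U_neg openin_U_neg])
  qed
  also have "\<dots> \<le> rel_index G U (v 1) ^ n"
  proof (induction n)
    case 0
    then show ?case by (simp add: rel_index_U_neg_0)
  next
    case (Suc n)
    from mult_le_mono[OF Suc U_neg_index_step_le[of n]]
    show ?case by (simp add: rel_index_U_neg_Suc mult.commute)
  qed
  finally show ?thesis .
qed

text \<open>For tidy \<open>U\<close> nothing is lost in the previous estimate: the chain ends exactly at
  \<open>U \<inter> \<alpha>\<^sup>-\<^sup>n(U)\<close>, and all its steps have the same index.\<close>

lemma tidy_rel_index_v: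
  assumes "tidy G T \<alpha> U"
  shows "rel_index G U (v n) = rel_index G U (v 1) ^ n"
proof -
  have sub: "U \<inter> v (Suc i) \<subseteq> v i" for i using assms by (simp add: tidy_iff)
  have step: "rel_index G (U_neg G \<alpha> U i) (v (Suc i)) = rel_index G U (v 1)" for i
    using assms by (simp add: tidy_iff U_Int_v_imp_U_neg[OF sub])
  have "rel_index G U (U_neg G \<alpha> U n) = rel_index G U (v 1) ^ n"
    by (induction n) (simp_all add: rel_index_U_neg_0[simplified] rel_index_U_neg_Suc step)
  then show ?thesis
    using rel_index_Int_absorb[OF subgroup_U subgroup_v, of n] U_Int_v_imp_U_neg[OF sub] by simp
qed

text \<open>Intersect everything with \<open>W\<close> and \<open>\<alpha>\<^sup>-\<^sup>n(W)\<close>.  The extra factors are \<open>[U : U \<inter> W]\<close> and an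
  index that \<open>\<alpha>\<^sup>n\<close> maps into \<open>W\<close>, where it is at most \<open>[W : W \<inter> U]\<close>; neither bound depends on
  \<open>n\<close>.\<close>

lemma rel_index_v_compare:
  assumes W: "compact_open W"
  shows "rel_index G U (v n) \<le>
    rel_index G U W * rel_index G W U * rel_index G W (preimage_iter G \<alpha> n W)"
proof -
  interpret W: tdlc_endo_subgroup G T \<alpha> W by unfold_locales (rule W)
  note sg = subgroup_U subgroup_v W.subgroup_U W.subgroup_v subgroups_Inter_pair
  let ?D = "U \<inter> W \<inter> W.v n"
  have "rel_index G U (v n) \<le> rel_index G U (W \<inter> (W.v n \<inter> v n))"
    by (rule rel_index_antimono_right)
      (auto intro!: sg finite_left_cosets_in openin_Int openin_v W.openin_v W.openin_U compactin_U U_carrier)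
  also have "\<dots> = rel_index G U W * (rel_index G (U \<inter> W) (W.v n) * rel_index G ?D (v n))"
    by (simp add: rel_index_Int sg)
  also have "\<dots> \<le> rel_index G U W * (rel_index G W (W.v n) * rel_index G W U)"
  proof (intro mult_le_mono order_refl)
    show "rel_index G (U \<inter> W) (W.v n) \<le> rel_index G W (W.v n)"
      by (intro rel_index_mono_left W.finite_cosets_v W.compactin_U) auto
    have "rel_index G ?D (v n) = rel_index G ((\<alpha> ^^ n) ` ?D) U"
      by (rule rel_index_preimage_iter[OF _ subgroup_U]) (auto intro: U_carrier)
    also have "\<dots> \<le> rel_index G W U"
      by (intro rel_index_mono_left finite_left_cosets_in W.compactin_U subgroup_U openin_U)
        (auto simp: mem_preimage_iter)
    finally show "rel_index G ?D (v n) \<le> rel_index G W U" .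
  qed
  finally show ?thesis by (simp add: ac_simps)
qed

text \<open>A competitor \<open>W\<close> of index \<open>d\<close> gives \<open>c\<^sup>n \<le> Kd\<^sup>n\<close> for all \<open>n\<close> with a constant \<open>K\<close>, which forces
  \<open>c \<le> d\<close>.\<close>

theorem scale_tidy:
  assumes "tidy G T \<alpha> U"
  shows "scale G T \<alpha> = rel_index G U (v 1)"
  unfolding scale_def
proof (rule Least_equality)
  show "\<exists>W. compact_open W \<and> rel_index G U (v 1) = subgroup_index G (\<alpha> ` W) (W \<inter> \<alpha> ` W)"
    using compact_open_U subgroup_index_eq by metis
next
  fix d assume "\<exists>W. compact_open W \<and> d = subgroup_index G (\<alpha> ` W) (W \<inter> \<alpha> ` W)"
  then obtain W where W: "compact_open W" "d = subgroup_index G (\<alpha> ` W) (W \<inter> \<alpha> ` W)" by blast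
  interpret W: tdlc_endo_subgroup G T \<alpha> W by unfold_locales (rule W)
  have d: "d = rel_index G W (W.v 1)" using W(2) W.subgroup_index_eq by simp
  then have d_pos: "d > 0" using W.rel_index_U_v_pos by simp
  let ?c = "rel_index G U (v 1)" and ?K = "rel_index G U W * rel_index G W U"
  have bound: "?c ^ n \<le> ?K * d ^ n" for n
  proof -
    have "?c ^ n = rel_index G U (v n)" by (rule tidy_rel_index_v[OF assms, symmetric])
    also have "\<dots> \<le> ?K * rel_index G W (W.v n)" by (rule rel_index_v_compare[OF W(1)])
    also have "\<dots> \<le> ?K * d ^ n" unfolding d by (rule mult_le_mono2[OF W.rel_index_v_le])
    finally show ?thesis .
  qed
  show "?c \<le> d"
  proof (rule ccontr)
    assume "\<not> ?c \<le> d"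
    then have "1 < real ?c / real d" using d_pos by (simp add: field_simps)
    then obtain n where n: "real ?K < (real ?c / real d) ^ n" using real_arch_pow by blast
    have "real (?c ^ n) \<le> real (?K * d ^ n)" using bound[of n] by (rule of_nat_mono)
    then have "(real ?c / real d) ^ n \<le> real ?K"
      using d_pos by (simp add: power_divide divide_le_eq)
    then show False using n by simp
  qed
qed

section \<open>Finitely many preimages\<close>

lemma v_periodic:
  assumes "v i = v j" "i < j"
  shows "v n \<in> v ` {..<j}"
proof (induction n rule: less_induct)
  case (less n)
  show ?case
  proof (cases "n < j")
    case False
    have shift: "v (k + m) = preimage_iter G \<alpha> m (v k)" for k m
      by (simp add: preimage_iter_add)
    have "v n = v (j + (n - j))" using False by simp
    also have "\<dots> = v (i + (n - j))" unfolding shift using assms(1) by simp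
    finally show ?thesis using less.IH[of "i + (n - j)"] False assms(2) by simp
  qed simp
qed

lemma inj_v:
  assumes "infinite (range v)"
  shows "inj v"
proof (rule linorder_injI)
  fix i j :: nat assume "i < j"
  show "v i \<noteq> v j"
  proof
    assume "v i = v j"
    then have "range v \<subseteq> v ` {..<j}" using v_periodic \<open>i < j\<close> by blast
    then show False using assms finite_subset by blast
  qed
qed

lemma finite_v_invariant_subgroup:
  assumes "finite (range v)"
  shows "\<exists>V. compact_open V \<and> \<alpha> ` V \<subseteq> V \<and> tidy G T \<alpha> V \<and> scale G T \<alpha> = 1"
proof -
  let ?V = "U_minus G \<alpha> U"
  have "?V = \<Inter>(range v)" by (auto simp: mem_U_minus mem_preimage_iter)
  moreover have "openin T (\<Inter>(range v))" by (rule openin_Inter[OF assms]) (auto simp: openin_v)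
  ultimately have "openin T ?V" by simp
  moreover have "compactin T ?V"
    using compactin_Int_closed[OF closedin_U_minus] U_minus_subset by (metis inf.absorb2)
  ultimately have co: "compact_open ?V" by (simp add: compact_open_subgroup_def subgroup_U_minus)
  interpret V: tdlc_endo_subgroup G T \<alpha> ?V by unfold_locales (rule co)
  have inv: "(\<alpha> ^^ n) x \<in> ?V" if "x \<in> ?V" for x n
    using iter_U_minus[of 0 x n] that by simp
  have sub: "?V \<subseteq> V.v n" for n using inv by (auto simp: mem_preimage_iter mem_U_minus)
  have ne: "?V \<noteq> {}" using subgroup.one_closed[OF subgroup_U_minus] by blast
  have idx: "rel_index G ?V (V.v n) = 1" for n by (rule rel_index_eq_1[OF V.subgroup_v sub ne])
  have tidy: "tidy G T \<alpha> ?V"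
    unfolding V.tidy_iff using idx sub by (simp add: Int_absorb2 le_infI1)
  have "scale G T \<alpha> = 1" using V.scale_tidy[OF tidy] idx by simp
  then show ?thesis using co tidy inv[of _ 1] by auto
qed

end

section \<open>Graded digraphs with unique parents\<close>

lemma cas_with_proj:
  assumes "pre_digraph.cas (with_proj \<Gamma>) u p w" "p \<noteq> []"
  shows "fst (hd p) = u" "snd (last p) = w"
    "\<And>i. Suc i < length p \<Longrightarrow> snd (p ! i) = fst (p ! Suc i)"
    "pre_digraph.awalk_verts (with_proj \<Gamma>) u p = u # map snd p"
proof -
  have "fst (hd p) = u \<and> snd (last p) = w \<and>
    (\<forall>i. Suc i < length p \<longrightarrow> snd (p ! i) = fst (p ! Suc i)) \<and>
    pre_digraph.awalk_verts (with_proj \<Gamma>) u p = u # map snd p"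
    using assms
  proof (induction p arbitrary: u)
    case Nil
    then show ?case by simp
  next
    case (Cons e p)
    note simps = pre_digraph.cas.simps pre_digraph.awalk_verts.simps
    show ?case
    proof (cases "p = []")
      case True
      then show ?thesis using Cons.prems by (simp del: cas_with_proj_eq awalk_verts_with_proj_eq add: simps)
    next
      case False
      have e: "fst e = u" "pre_digraph.cas (with_proj \<Gamma>) (snd e) p w"
        using Cons.prems by (simp_all del: cas_with_proj_eq add: simps)
      note IH = Cons.IH[OF e(2) False]
      have "snd ((e # p) ! i) = fst ((e # p) ! Suc i)" if "Suc i < length (e # p)" for i
        using that IH False by (cases i) (auto simp: hd_conv_nth)
      then show ?thesis
        using IH e False by (simp del: awalk_verts_with_proj_eq add: simps)
    qed
  qed
  then show "fst (hd p) = u" "snd (last p) = w"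
    "\<And>i. Suc i < length p \<Longrightarrow> snd (p ! i) = fst (p ! Suc i)"
    "pre_digraph.awalk_verts (with_proj \<Gamma>) u p = u # map snd p"
    by blast+
qed

text \<open>At a vertex of maximal level, a cycle arrives from a parent and leaves to a parent.  The
  parent being unique, the cycle just runs along an edge and back.\<close>

lemma graded_cycle_trivial:
  fixes \<Gamma> :: "'v pair_pre_digraph" and level :: "'v \<Rightarrow> nat"
  assumes level: "\<And>x y. (x, y) \<in> parcs \<Gamma> \<Longrightarrow> level y = Suc (level x)"
    and parent: "\<And>x x' y. (x, y) \<in> parcs \<Gamma> \<Longrightarrow> (x', y) \<in> parcs \<Gamma> \<Longrightarrow> x = x'"
    and cycle: "pre_digraph.cycle (with_proj (mk_symmetric (with_proj \<Gamma>))) p"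
  shows "trivial_cycle \<Gamma> p"
proof -
  let ?S = "mk_symmetric (with_proj \<Gamma>)"
  obtain u where u: "pre_digraph.awalk (with_proj ?S) u p u"
    "distinct (tl (pre_digraph.awalk_verts (with_proj ?S) u p))" "p \<noteq> []"
    using cycle unfolding pre_digraph.cycle_def by blast
  then have arcs: "set p \<subseteq> parcs ?S" and cas: "pre_digraph.cas (with_proj ?S) u p u"
    unfolding pre_digraph.awalk_def by simp_all
  note c = cas_with_proj[OF cas u(3)]
  have dist: "distinct (map snd p)" using u(2) unfolding c(4) by simp
  define k where "k = length p"
  have k: "k > 0" using u(3) by (simp add: k_def)
  have adj: "(fst (p ! i), snd (p ! i)) \<in> parcs \<Gamma> \<or> (snd (p ! i), fst (p ! i)) \<in> parcs \<Gamma>"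
    if "i < k" for i
  proof -
    have "p ! i \<in> parcs ?S" using arcs that by (auto simp: k_def)
    then show ?thesis by (auto simp: mk_symmetric_def)
  qed
  have next_arc: "snd (p ! i) = fst (p ! (Suc i mod k))" if "i < k" for i
  proof (cases "Suc i < k")
    case True
    then show ?thesis using c(3)[of i] by (simp add: k_def)
  next
    case False
    then have "Suc i = k" using that by simp
    then have i: "i = k - 1" "Suc i mod k = 0" by auto
    show ?thesis using c(1,2) u(3) i by (simp add: k_def last_conv_nth hd_conv_nth)
  qed
  have inj: "i = j" if "i < k" "j < k" "snd (p ! i) = snd (p ! j)" for i j
    using dist that by (simp add: k_def distinct_conv_nth) blast
  have "\<exists>i<k. \<forall>j<k. level (snd (p ! j)) \<le> level (snd (p ! i))"
  proof -
    let ?L = "(\<lambda>i. level (snd (p ! i))) ` {..<k}"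
    have "Max ?L \<in> ?L" using k by (intro Max_in) auto
    then obtain i where "i < k" "level (snd (p ! i)) = Max ?L" by auto
    then show ?thesis by (intro exI[of _ i]) auto
  qed
  then obtain i where i: "i < k" "\<And>j. j < k \<Longrightarrow> level (snd (p ! j)) \<le> level (snd (p ! i))" by blast
  (* cyclic predecessor and successor of i; k - 1 stands for -1 modulo k *)
  define h j where "h = (i + (k - 1)) mod k" and "j = Suc i mod k"
  have hj: "h < k" "j < k" using k by (simp_all add: h_def j_def)
  have "Suc h mod k = i" using k i(1) by (simp add: h_def mod_Suc_eq)
  then have a: "fst (p ! i) = snd (p ! h)" using next_arc[OF hj(1)] by simp
  have m: "fst (p ! j) = snd (p ! i)" using next_arc[OF i(1)] by (simp add: j_def)
  have "(fst (p ! i), snd (p ! i)) \<in> parcs \<Gamma>"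
    using adj[OF i(1)] level i(2)[OF hj(1)] a by fastforce
  moreover have "(snd (p ! j), snd (p ! i)) \<in> parcs \<Gamma>"
    using adj[OF hj(2)] level i(2)[OF hj(2)] m by fastforce
  ultimately have par: "(snd (p ! h), snd (p ! i)) \<in> parcs \<Gamma>" and "snd (p ! h) = snd (p ! j)"
    using parent a by auto
  then have "h = j" using inj hj by blast
  have "k \<noteq> 1" using par level[OF par] hj(1) i(1) by auto
  have "k = 2"
  proof (rule ccontr)
    assume "k \<noteq> 2"
    then have k3: "k \<ge> 3" using k \<open>k \<noteq> 1\<close> by simp
    consider "i = 0" | "i > 0" "Suc i < k" | "Suc i = k" using i(1) by linarith
    then show False
    proof cases
      case 1
      then show ?thesis using \<open>h = j\<close> k3 by (simp add: h_def j_def)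
    next
      case 2
      then have "i + (k - 1) = (i - 1) + k" using k3 by simp
      then have "h = (i - 1) mod k" by (simp only: h_def mod_add_self2)
      then have "h = i - 1" using 2 by simp
      then show ?thesis using 2 \<open>h = j\<close> by (simp add: j_def)
    next
      case 3
      then have "i + (k - 1) = (i - 1) + k" using k3 by simp
      then have "h = (i - 1) mod k" by (simp only: h_def mod_add_self2)
      then have "h = i - 1" using 3 by simp
      then show ?thesis using 3 k3 \<open>h = j\<close> by (auto simp: j_def)
    qed
  qed
  then obtain e f where p: "p = [e, f]"
    unfolding k_def by (metis One_nat_def Suc_1 length_0_conv length_Suc_conv)
  have "snd e = fst f" "snd f = fst e"
    using next_arc[of 0] next_arc[of 1] \<open>k = 2\<close> by (simp_all add: p)
  then have "p = [(fst e, snd e), (snd e, fst e)]" by (simp add: p prod_eq_iff)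
  moreover have "\<not> ((fst e, snd e) \<in> parcs \<Gamma> \<and> (snd e, fst e) \<in> parcs \<Gamma>)"
    using level[of "fst e" "snd e"] level[of "snd e" "fst e"] by auto
  ultimately show ?thesis unfolding trivial_cycle_def by blast
qed

lemma graded_rooted_directed_tree:
  fixes \<Gamma> :: "'v pair_pre_digraph" and level :: "'v \<Rightarrow> nat"
  assumes wf: "pair_wf_digraph \<Gamma>"
    and root: "r \<in> pverts \<Gamma>" "\<And>x. x \<in> pverts \<Gamma> \<Longrightarrow> r \<rightarrow>\<^sup>*\<^bsub>with_proj \<Gamma>\<^esub> x"
    and level: "\<And>x y. (x, y) \<in> parcs \<Gamma> \<Longrightarrow> level y = Suc (level x)"
    and parent: "\<And>x x' y. (x, y) \<in> parcs \<Gamma> \<Longrightarrow> (x', y) \<in> parcs \<Gamma> \<Longrightarrow> x = x'"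
  shows "directed_tree \<Gamma>" "rooted_at \<Gamma> r"
proof -
  have wfp: "wf_digraph (with_proj \<Gamma>)" using wf by (simp add: wf_digraph_wp_iff)
  let ?S = "with_proj (mk_symmetric (with_proj \<Gamma>))"
  have wfS: "wf_digraph ?S"
    using wf_digraph.wellformed[OF wfp]
    by (auto simp: wf_digraph_def mk_symmetric_def)
  have reach: "r \<rightarrow>\<^sup>*\<^bsub>?S\<^esub> x" if "x \<in> pverts \<Gamma>" for x
    using wf_digraph.reachable_mk_symmetricI[OF wfp root(2)[OF that]] .
  have "Digraph_Component.connected (with_proj \<Gamma>)"
    unfolding Digraph_Component.connected_def
  proof (rule strongly_connectedI)
    show "verts ?S \<noteq> {}" using root(1) by (auto simp: mk_symmetric_def)
    fix x y assume "x \<in> verts ?S" "y \<in> verts ?S"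
    then have xy: "x \<in> pverts \<Gamma>" "y \<in> pverts \<Gamma>" by (auto simp: mk_symmetric_def)
    have "x \<rightarrow>\<^sup>*\<^bsub>?S\<^esub> r" by (rule symmetric_reachable[OF symmetric_mk_symmetric reach[OF xy(1)]])
    then show "x \<rightarrow>\<^sup>*\<^bsub>?S\<^esub> y" using reach[OF xy(2)] wf_digraph.reachable_trans[OF wfS] by blast
  qed
  then show "directed_tree \<Gamma>"
    unfolding directed_tree_def using wf graded_cycle_trivial[of \<Gamma> level, OF level parent] by simp
  show "rooted_at \<Gamma> r"
    unfolding rooted_at_def using root wf_digraph.reachable_apath[OF wfp] by blast
qed

section \<open>The graph of preimages\<close>

context tdlc_endo_subgroup
begin

abbreviation \<Gamma> :: "'a set pair_pre_digraph" where
  "\<Gamma> \<equiv> Gamma_plus G \<alpha> U"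

lemma pverts_\<Gamma>: "x \<in> pverts \<Gamma> \<longleftrightarrow> (\<exists>u i. x = u <# v i \<and> u \<in> U)"
  and parcs_\<Gamma>: "e \<in> parcs \<Gamma> \<longleftrightarrow> (\<exists>u i. e = (u <# v i, u <# v (Suc i)) \<and> u \<in> U)"
  by (auto simp: Gamma_plus_def)

lemma wf_\<Gamma>: "pair_wf_digraph \<Gamma>"
proof (rule pair_wf_digraph.intro)
  fix e assume "e \<in> parcs \<Gamma>"
  then obtain u i where "e = (u <# v i, u <# v (Suc i))" "u \<in> U" by (auto simp: parcs_\<Gamma>)
  then show "fst e \<in> pverts \<Gamma>" "snd e \<in> pverts \<Gamma>"
    unfolding pverts_\<Gamma> fst_conv snd_conv by auto
qed

lemma one_l_coset_v: "\<one> <# v i = v i"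
  using lcos_mult_one subgroup.subset[OF subgroup_v] by blast

lemma one_U: "\<one> \<in> U" by (rule subgroup.one_closed[OF subgroup_U])

lemma v_in_\<Gamma>: "v i \<in> pverts \<Gamma>"
  unfolding pverts_\<Gamma> using one_l_coset_v one_U by metis

lemma U_l_coset_v_0: "u \<in> U \<Longrightarrow> u <# v 0 = v 0"
  using coset_join3[OF _ subgroup_U] U_carrier by (simp add: v_0)

lemma reachable_\<Gamma>: "x \<in> pverts \<Gamma> \<Longrightarrow> v 0 \<rightarrow>\<^sup>*\<^bsub>with_proj \<Gamma>\<^esub> x"
proof -
  have wf: "wf_digraph (with_proj \<Gamma>)" using wf_\<Gamma> by (simp add: wf_digraph_wp_iff)
  assume "x \<in> pverts \<Gamma>"
  then obtain u i where x: "x = u <# v i" and u: "u \<in> U" by (auto simp: pverts_\<Gamma>)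
  show ?thesis unfolding x
  proof (induction i)
    case 0
    then show ?case using U_l_coset_v_0[OF u] wf_digraph.reachable_refl[OF wf] v_in_\<Gamma> by simp
  next
    case (Suc i)
    have "(u <# v i, u <# v (Suc i)) \<in> arcs_ends (with_proj \<Gamma>)" using u by (auto simp: parcs_\<Gamma>)
    then show ?case by (rule wf_digraph.reachable_adj_trans[OF wf Suc])
  qed
qed

text \<open>A coset determines its subgroup, \<open>B = (aB)\<^sup>-\<^sup>1aB\<close>.  So if the \<open>\<alpha>\<^sup>-\<^sup>i(U)\<close> are pairwise
  distinct, every vertex has a well-defined level.\<close>

lemma l_coset_v_level:
  assumes "inj v" "u \<in> carrier G" "w \<in> carrier G" "u <# v i = w <# v j"
  shows "i = j"
proof -
  have w: "w \<in> u <# v i" using assms(4) lcos_self[OF assms(3) subgroup_v] by simp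
  then have "w <# v i = w <# v j"
    using l_repr_independence[OF w assms(2) subgroup_v] assms(4) by simp
  have "v i = v j"
  proof -
    have mem: "x \<in> v m \<longleftrightarrow> x \<in> carrier G \<and> w \<otimes> x \<in> w <# v m" for x m
      using l_coset_mem_iff[OF subgroup.subset[OF subgroup_v] assms(3), of "w \<otimes> x" m] assms(3)
        subgroup.mem_carrier[OF subgroup_v]
      by (auto simp: m_assoc[symmetric])
    then show ?thesis using \<open>w <# v i = w <# v j\<close> by blast
  qed
  then show ?thesis by (rule injD[OF assms(1)])
qed

text \<open>Translation by \<open>u\<^sup>-\<^sup>1\<close> moves the vertex to \<open>\<alpha>\<^sup>-\<^sup>i(U)\<close>, whose children are the cosets
  \<open>w\<alpha>\<^sup>-\<^sup>i\<^sup>-\<^sup>1(U)\<close> with \<open>w \<in> U \<inter> \<alpha>\<^sup>-\<^sup>i(U)\<close>; distinct levels exclude any others.\<close>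

lemma out_arcs_\<Gamma>:
  assumes "inj v" "u \<in> U"
  shows "out_arcs (with_proj \<Gamma>) (u <# v i) \<approx> left_cosets_in G (U \<inter> v i) (v (Suc i))"
proof -
  have uc: "u \<in> carrier G" using assms(2) U_carrier by blast
  have "out_arcs (with_proj \<Gamma>) (u <# v i) =
      (\<lambda>w. (u <# v i, (u \<otimes> w) <# v (Suc i))) ` (U \<inter> v i)"
  proof
    show "out_arcs (with_proj \<Gamma>) (u <# v i) \<subseteq> (\<lambda>w. (u <# v i, (u \<otimes> w) <# v (Suc i))) ` (U \<inter> v i)"
    proof
      fix e assume "e \<in> out_arcs (with_proj \<Gamma>) (u <# v i)"
      then obtain w j where w: "e = (w <# v j, w <# v (Suc j))" "w \<in> U" "w <# v j = u <# v i"
        by (auto simp: out_arcs_def parcs_\<Gamma>)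
      have wc: "w \<in> carrier G" using w U_carrier by blast
      have j: "j = i" using l_coset_v_level[OF assms(1) wc uc w(3)] .
      have "inv u \<otimes> w \<in> v i"
        using w(3) l_coset_eq_iff[OF subgroup_v uc wc] unfolding j by metis
      moreover have "inv u \<otimes> w \<in> U"
        using w assms(2) subgroup.m_closed[OF subgroup_U] subgroup.m_inv_closed[OF subgroup_U] by blast
      moreover have "u \<otimes> (inv u \<otimes> w) = w" using uc wc by (simp add: m_assoc[symmetric])
      ultimately show "e \<in> (\<lambda>w. (u <# v i, (u \<otimes> w) <# v (Suc i))) ` (U \<inter> v i)"
        using w(1,3) j by (intro image_eqI[of _ _ "inv u \<otimes> w"]) auto
    qed
    show "(\<lambda>w. (u <# v i, (u \<otimes> w) <# v (Suc i))) ` (U \<inter> v i) \<subseteq> out_arcs (with_proj \<Gamma>) (u <# v i)"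
    proof clarify
      fix w assume w: "w \<in> U" "w \<in> v i"
      have wc: "w \<in> carrier G" using w U_carrier by blast
      have "inv u \<otimes> (u \<otimes> w) \<in> v i" using w uc wc by (simp add: m_assoc[symmetric])
      then have "u <# v i = (u \<otimes> w) <# v i" using uc wc by (simp add: l_coset_eq_iff[OF subgroup_v])
      moreover have "u \<otimes> w \<in> U" using w assms(2) subgroup.m_closed[OF subgroup_U] by blast
      ultimately show "(u <# v i, (u \<otimes> w) <# v (Suc i)) \<in> out_arcs (with_proj \<Gamma>) (u <# v i)"
        by (auto simp: out_arcs_def parcs_\<Gamma>)
    qed
  qed
  also have "\<dots> \<approx> (\<lambda>w. w <# v (Suc i)) ` (U \<inter> v i)"
  proof (rule image_eqpoll_image)
    fix a b assume "a \<in> U \<inter> v i" "b \<in> U \<inter> v i"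
    then have "a \<in> carrier G" "b \<in> carrier G" using U_carrier by auto
    moreover from this have "inv (u \<otimes> a) \<otimes> (u \<otimes> b) = inv a \<otimes> b"
      using uc by (simp add: inv_mult_group m_assoc) (simp add: m_assoc[symmetric])
    ultimately show "(u <# v i, (u \<otimes> a) <# v (Suc i)) = (u <# v i, (u \<otimes> b) <# v (Suc i)) \<longleftrightarrow>
        a <# v (Suc i) = b <# v (Suc i)"
      using uc by (simp add: l_coset_eq_iff[OF subgroup_v])
  qed
  finally show ?thesis by (simp add: left_cosets_in_def)
qed

lemma out_degree_\<Gamma>:
  assumes "inj v" "u \<in> U"
  shows "finite (out_arcs (with_proj \<Gamma>) (u <# v i))"
    "out_degree (with_proj \<Gamma>) (u <# v i) = rel_index G (U \<inter> v i) (v (Suc i))"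
  using out_arcs_\<Gamma>[OF assms] finite_cosets_v[OF compactin_Int_closed[OF closedin_v]]
  by (auto simp: out_degree_def rel_index_def eqpoll_def dest: bij_betw_same_card bij_betw_finite)

lemma constant_out_valency_\<Gamma>_iff:
  assumes "inj v"
  shows "constant_out_valency \<Gamma> \<longleftrightarrow>
    (\<forall>i. rel_index G (U \<inter> v i) (v (Suc i)) = rel_index G U (v 1))"
proof -
  have fin: "finite (out_arcs (with_proj \<Gamma>) x)" if "x \<in> pverts \<Gamma>" for x
    using that out_degree_\<Gamma>(1)[OF assms] by (auto simp: pverts_\<Gamma>)
  have deg: "out_degree (with_proj \<Gamma>) (u <# v i) = rel_index G (U \<inter> v i) (v (Suc i))"
    if "u \<in> U" for u i by (rule out_degree_\<Gamma>(2)[OF assms that])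
  have deg_v: "out_degree (with_proj \<Gamma>) (v i) = rel_index G (U \<inter> v i) (v (Suc i))" for i
    using deg[OF one_U, of i] by (simp only: one_l_coset_v)
  have "constant_out_valency \<Gamma> \<longleftrightarrow> (\<forall>x \<in> pverts \<Gamma>. \<forall>y \<in> pverts \<Gamma>.
      out_degree (with_proj \<Gamma>) x = out_degree (with_proj \<Gamma>) y)"
    unfolding constant_out_valency_def out_degree_def using fin by (simp add: eqpoll_iff_card)
  also have "\<dots> \<longleftrightarrow> (\<forall>i. rel_index G (U \<inter> v i) (v (Suc i)) = rel_index G U (v 1))"
  proof
    assume eq: "\<forall>x \<in> pverts \<Gamma>. \<forall>y \<in> pverts \<Gamma>.
      out_degree (with_proj \<Gamma>) x = out_degree (with_proj \<Gamma>) y"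
    show "\<forall>i. rel_index G (U \<inter> v i) (v (Suc i)) = rel_index G U (v 1)"
    proof
      fix i
      have "out_degree (with_proj \<Gamma>) (v i) = out_degree (with_proj \<Gamma>) (v 0)"
        using eq v_in_\<Gamma> by blast
      then show "rel_index G (U \<inter> v i) (v (Suc i)) = rel_index G U (v 1)"
        using deg_v[of i] deg_v[of 0] by (simp add: v_0)
    qed
  next
    assume eq: "\<forall>i. rel_index G (U \<inter> v i) (v (Suc i)) = rel_index G U (v 1)"
    have "out_degree (with_proj \<Gamma>) x = rel_index G U (v 1)" if x: "x \<in> pverts \<Gamma>" for x
    proof -
      obtain u i where "x = u <# v i" "u \<in> U" using x unfolding pverts_\<Gamma> by blast
      then show ?thesis using deg eq by simp
    qed
    then show "\<forall>x \<in> pverts \<Gamma>. \<forall>y \<in> pverts \<Gamma>.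
      out_degree (with_proj \<Gamma>) x = out_degree (with_proj \<Gamma>) y" by simp
  qed
  finally show ?thesis .
qed

text \<open>For each \<open>x \<in> U \<inter> \<alpha>\<^sup>-\<^sup>i\<^sup>-\<^sup>1(U)\<close> the coset \<open>x\<alpha>\<^sup>-\<^sup>i(U)\<close> is a parent of
  \<open>\<alpha>\<^sup>-\<^sup>i\<^sup>-\<^sup>1(U)\<close>, as is \<open>\<alpha>\<^sup>-\<^sup>i(U)\<close> itself.\<close>

lemma in_degree_\<Gamma>_imp_subset:
  assumes "in_degree (with_proj \<Gamma>) (v (Suc i)) = 1"
  shows "U \<inter> v (Suc i) \<subseteq> v i"
proof clarify
  fix x assume x: "x \<in> U" "x \<in> v (Suc i)"
  have xc: "x \<in> carrier G" using x U_carrier by blast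
  have "x <# v (Suc i) = v (Suc i)" by (rule coset_join3[OF xc subgroup_v x(2)])
  then have "(x <# v i, v (Suc i)) \<in> parcs \<Gamma>" using x(1) unfolding parcs_\<Gamma> by metis
  then have "(x <# v i, v (Suc i)) \<in> in_arcs (with_proj \<Gamma>) (v (Suc i))" by (simp add: in_arcs_def)
  moreover have "(v i, v (Suc i)) \<in> parcs \<Gamma>"
    using one_U one_l_coset_v unfolding parcs_\<Gamma> by metis
  then have "(v i, v (Suc i)) \<in> in_arcs (with_proj \<Gamma>) (v (Suc i))" by (simp add: in_arcs_def)
  moreover obtain e where "in_arcs (with_proj \<Gamma>) (v (Suc i)) = {e}"
    using assms unfolding in_degree_def by (metis card_1_singletonE)
  ultimately have "x <# v i = v i" by auto
  then show "x \<in> v i" using lcos_self[OF xc subgroup_v] by metis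
qed

lemma parent_unique:
  assumes "inj v" "\<And>i. U \<inter> v (Suc i) \<subseteq> v i" "(x, y) \<in> parcs \<Gamma>" "(x', y) \<in> parcs \<Gamma>"
  shows "x = x'"
proof -
  obtain u i where u: "x = u <# v i" "y = u <# v (Suc i)" "u \<in> U" using assms(3) by (auto simp: parcs_\<Gamma>)
  obtain w j where w: "x' = w <# v j" "y = w <# v (Suc j)" "w \<in> U" using assms(4) by (auto simp: parcs_\<Gamma>)
  have c: "u \<in> carrier G" "w \<in> carrier G" using u w U_carrier by blast+
  have eq: "u <# v (Suc i) = w <# v (Suc j)" using u w by simp
  have j: "j = i" using l_coset_v_level[OF assms(1) c eq] by simp
  have "inv u \<otimes> w \<in> v (Suc i)" using eq unfolding j by (simp only: l_coset_eq_iff[OF subgroup_v c])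
  moreover have "inv u \<otimes> w \<in> U"
    using u w subgroup.m_closed[OF subgroup_U] subgroup.m_inv_closed[OF subgroup_U] by blast
  ultimately have "inv u \<otimes> w \<in> v i" using assms(2) by blast
  then show ?thesis unfolding u w j using l_coset_eq_iff[OF subgroup_v c] by blast
qed

lemma in_degree_\<Gamma>:
  assumes "inj v" "\<And>i. U \<inter> v (Suc i) \<subseteq> v i" "x \<in> pverts \<Gamma>" "x \<noteq> v 0"
  shows "in_degree (with_proj \<Gamma>) x = 1"
proof -
  obtain u i where x: "x = u <# v i" "u \<in> U" using assms(3) by (auto simp: pverts_\<Gamma>)
  then obtain k where k: "i = Suc k" using assms(4) U_l_coset_v_0 by (cases i) auto
  have e: "(u <# v k, x) \<in> parcs \<Gamma>" using x k by (auto simp: parcs_\<Gamma>)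
  have "in_arcs (with_proj \<Gamma>) x = {(u <# v k, x)}"
  proof (intro subset_antisym subsetI)
    fix a assume "a \<in> in_arcs (with_proj \<Gamma>) x"
    then have "(fst a, x) \<in> parcs \<Gamma>" "snd a = x" by (auto simp: in_arcs_def)
    then have "a = (u <# v k, x)"
      using parent_unique[OF assms(1,2) _ e, of "fst a"] by (simp add: prod_eq_iff)
    then show "a \<in> {(u <# v k, x)}" by blast
  qed (use e in \<open>simp add: in_arcs_def\<close>)
  then show ?thesis by (simp add: in_degree_def)
qed

lemma \<Gamma>_directed_tree:
  assumes "inj v" "\<And>i. U \<inter> v (Suc i) \<subseteq> v i"
  shows "directed_tree \<Gamma>" "rooted_at \<Gamma> (v 0)"
proof -
  define level where "level x = (SOME i. \<exists>u \<in> U. x = u <# v i)" for x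
  have level: "level (u <# v i) = i" if u: "u \<in> U" for u i
  proof -
    have "\<exists>w \<in> U. u <# v i = w <# v (level (u <# v i))"
      unfolding level_def by (rule someI[of _ i]) (use u in blast)
    then show ?thesis using l_coset_v_level[OF assms(1)] u U_carrier by metis
  qed
  note tree = graded_rooted_directed_tree[OF wf_\<Gamma> v_in_\<Gamma> reachable_\<Gamma>, of level]
  have lev: "level y = Suc (level x)" if "(x, y) \<in> parcs \<Gamma>" for x y
    using that level by (auto simp: parcs_\<Gamma>)
  show "directed_tree \<Gamma>" by (rule tree(1)) (use lev parent_unique[OF assms] in blast)+
  show "rooted_at \<Gamma> (v 0)" by (rule tree(2)) (use lev parent_unique[OF assms] in blast)+
qed

theorem tidy_iff_tree:
  assumes "inj v"
  shows "tidy G T \<alpha> U \<longleftrightarrow>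
    directed_tree \<Gamma> \<and> rooted_at \<Gamma> (v 0) \<and>
    (\<forall>x \<in> pverts \<Gamma> - {v 0}. in_degree (with_proj \<Gamma>) x = 1) \<and>
    constant_out_valency \<Gamma>"
proof
  assume "tidy G T \<alpha> U"
  then have "\<And>i. U \<inter> v (Suc i) \<subseteq> v i" "constant_out_valency \<Gamma>"
    unfolding tidy_iff constant_out_valency_\<Gamma>_iff[OF assms] by blast+
  then show "directed_tree \<Gamma> \<and> rooted_at \<Gamma> (v 0) \<and>
    (\<forall>x \<in> pverts \<Gamma> - {v 0}. in_degree (with_proj \<Gamma>) x = 1) \<and> constant_out_valency \<Gamma>"
    using \<Gamma>_directed_tree[OF assms] in_degree_\<Gamma>[OF assms] by blast
next
  assume tree: "directed_tree \<Gamma> \<and> rooted_at \<Gamma> (v 0) \<and>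
    (\<forall>x \<in> pverts \<Gamma> - {v 0}. in_degree (with_proj \<Gamma>) x = 1) \<and> constant_out_valency \<Gamma>"
  have "U \<inter> v (Suc i) \<subseteq> v i" for i
  proof (rule in_degree_\<Gamma>_imp_subset)
    have "v (Suc i) \<noteq> v 0" using injD[OF assms, of "Suc i" 0] by blast
    then show "in_degree (with_proj \<Gamma>) (v (Suc i)) = 1" using tree v_in_\<Gamma> by blast
  qed
  then show "tidy G T \<alpha> U"
    using tree unfolding tidy_iff constant_out_valency_\<Gamma>_iff[OF assms] by blast
qed

theorem tidy_out_degree_eq_scale:
  assumes "inj v" "tidy G T \<alpha> U" "x \<in> pverts \<Gamma>"
  shows "finite (out_arcs (with_proj \<Gamma>) x)" "out_degree (with_proj \<Gamma>) x = scale G T \<alpha>"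
proof -
  obtain u i where x: "x = u <# v i" "u \<in> U" using assms(3) by (auto simp: pverts_\<Gamma>)
  show "finite (out_arcs (with_proj \<Gamma>) x)" unfolding x(1) by (rule out_degree_\<Gamma>(1)[OF assms(1) x(2)])
  have "out_degree (with_proj \<Gamma>) x = rel_index G U (v 1)"
    using assms(2) unfolding x(1) out_degree_\<Gamma>(2)[OF assms(1) x(2)] tidy_iff by blast
  then show "out_degree (with_proj \<Gamma>) x = scale G T \<alpha>" by (simp add: scale_tidy[OF assms(2)])
qed

end

section \<open>The characterisation of tidy subgroups\<close>

theorem mainTheorem1:
  fixes G :: "('a, 'b) monoid_scheme" and T :: "'a topology"
    and \<alpha> :: "'a \<Rightarrow> 'a" and U :: "'a set"
  assumes "tdlc_group G T"
    and "\<alpha> \<in> continuous_End G T"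
    and "compact_open_subgroup G T U"
  shows
    "(finite {preimage_iter G \<alpha> i U | i. True} \<longrightarrow>
        (\<exists>V. compact_open_subgroup G T V \<and> \<alpha> ` V \<subseteq> V \<and> tidy G T \<alpha> V) \<and> scale G T \<alpha> = 1)
     \<and>
     (infinite {preimage_iter G \<alpha> i U | i. True} \<longrightarrow>
        (tidy G T \<alpha> U \<longleftrightarrow>
           directed_tree (Gamma_plus G \<alpha> U) \<and>
           rooted_at (Gamma_plus G \<alpha> U) (preimage_iter G \<alpha> 0 U) \<and>
           (\<forall>v \<in> pverts (Gamma_plus G \<alpha> U) - {preimage_iter G \<alpha> 0 U}.
              in_degree (with_proj (Gamma_plus G \<alpha> U)) v = 1) \<and>
           constant_out_valency (Gamma_plus G \<alpha> U)) \<and>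
        (tidy G T \<alpha> U \<longrightarrow>
           (\<forall>v \<in> pverts (Gamma_plus G \<alpha> U).
              finite (out_arcs (with_proj (Gamma_plus G \<alpha> U)) v) \<and>
              out_degree (with_proj (Gamma_plus G \<alpha> U)) v = scale G T \<alpha>)))"
proof -
  interpret tdlc_endo_subgroup G T \<alpha> U
    using assms by (simp add: tdlc_endo_subgroup_def tdlc_endo_def tdlc_endo_axioms_def
        tdlc_endo_subgroup_axioms_def)
  have range: "{preimage_iter G \<alpha> i U | i. True} = range v" by auto
  show ?thesis
    unfolding range
    using finite_v_invariant_subgroup tidy_iff_tree[OF inj_v] tidy_out_degree_eq_scale[OF inj_v] by auto
qed

end
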